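(* Let $F:2^{[n]}\to\mathbb{R}$ be submodular with $F(\emptyset)=0$ and Lovász extension $f$, let $g:\mathbb{R}^n\to\mathbb{R}$ be $\beta$-strongly convex, let $M$ be the diameter of $B(F)$, and let $p^\star=\min_{x\in\mathbb{R}^n}g(x)+f(x)$. Then at every iteration $i$ of OSM on $(g,F)$ the duality gap $p^{(i)}-d^{(i)}$ satisfies $$p^{(i)}-d^{(i)}\le (p^\star-d^{(i)})+\frac{M^2}{2\beta}\quad\text{if } p^\star-d^{(i)}\ge \frac{M^2}{2\beta},$$ $$p^{(i)}-d^{(i)}\le M\sqrt{2(p^\star-d^{(i)})/\beta}\quad\text{otherwise.}$$ If in addition $g$ is $\alpha$-smooth (and $B(F)$ is not a single point), then $p^\star-d^{(i)}$, and hence the duality gap, converges linearly: $p^\star-d^{(i+1)}\le(1-\rho)(p^\star-d^{(i)})$ for all $i\ge 1$ such that iterations $i$ and $i+1$ are performed, where $\rho=\frac{\beta}{4\alpha}(\delta/M)^2$ and $\delta$ is the pyramidal width of $B(F)$.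
   Context: $[n]=\{1,\dots,n\}$. $F$ is submodular if $F(A)+F(B)\ge F(A\cup B)+F(A\cap B)$ for all $A,B\subseteq[n]$. With $w(A)=\sum_{k\in A}w_k$, the base polytope is $B(F)=\{w\in\mathbb{R}^n: w(A)\le F(A)\ \forall A\subseteq[n],\ w([n])=F([n])\}$, with vertex set $\mathrm{vert}(B(F))$; the Lovász extension is $f(x)=\max_{w\in B(F)}w^\top x$. A function $g$ is $\beta$-strongly convex ($\beta>0$) if $g-\frac{\beta}{2}\|\cdot\|_2^2$ is convex, and $\alpha$-smooth ($\alpha>0$) if $g-\frac{\alpha}{2}\|\cdot\|_2^2$ is concave. Algorithm OSM (Original Simplicial Method) with tolerance $\epsilon\ge 0$: choose a nonempty set $\mathcal{V}^{(0)}\subseteq\mathrm{vert}(B(F))$. For $i=1,2,\dots$: (1) let $f_{(i)}(x)=\max\{w^\top x: w\in\mathcal{V}^{(i-1)}\}$ and let $x^{(i)}$ be the (unique) minimizer of $g+f_{(i)}$ over $\mathbb{R}^n$; (2) choose a vertex $v^{(i)}\in\mathrm{vert}(B(F))$ maximizing $w^\top x^{(i)}$ over $w\in B(F)$; (3) let $p^{(i)}=g(x^{(i)})+f(x^{(i)})$, $d^{(i)}=g(x^{(i)})+f_{(i)}(x^{(i)})$; stop if $p^{(i)}-d^{(i)}\le\epsilon$; (4) otherwise let $\mathcal{V}^{(i)}=\mathcal{V}^{(i-1)}\cup\{v^{(i)}\}$. Diameter: $\mathrm{Diam}(\mathcal{P})=\max_{v,w\in\mathcal{P}}\|v-w\|_2$.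 Directional width of a set $\mathcal{P}$ in direction $x\ne0$: $\mathrm{dirW}(\mathcal{P},x)=\max_{v,w\in\mathcal{P}}(v-w)^\top x/\|x\|_2$. For a finite set $\mathcal{V}\subset\mathbb{R}^n$, a direction $x\neq 0$ and $w\in\mathrm{conv}(\mathcal{V})$, the pyramid directional width is $\mathrm{PdirW}(\mathcal{V},x,w)=\min_{A\in\mathcal{A}(w)}\mathrm{dirW}(A\cup\{v(\mathcal{V},x)\},x)$, where $\mathcal{A}(w)$ is the collection of $A\subseteq\mathcal{V}$ such that $w$ is a convex combination of the elements of $A$ with all multipliers nonzero, and $v(\mathcal{V},x)$ is an element of $\operatorname{argmax}_{v\in\mathcal{V}}v^\top x$. The pyramidal width of a polytope $\mathcal{P}$ is $$\mathrm{PWidth}(\mathcal{P})=\min_{\mathcal{K}\in\mathrm{face}(\mathcal{P})}\ \min_{w\in\mathcal{K},\ x\in\mathrm{cone}(\mathcal{K}-w)\setminus\{0\}}\mathrm{PdirW}(\mathcal{K}\cap\mathrm{vert}(\mathcal{P}),x,w),$$ where $\mathrm{face}(\mathcal{P})$ is the set of faces of $\mathcal{P}$ (including $\mathcal{P}$) and $\mathrm{cone}(\mathcal{K}-w)$ is the cone of directions pointing from $w$ into $\mathcal{K}$. *)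

theory Defs
  imports "HOL-Analysis.Analysis"
begin

text \<open>
  The ground set is the finite index type \<open>'n\<close>, so set functions have type
  \<open>'n set \<Rightarrow> real\<close> and vectors type \<open>real^'n\<close>.
  The maxima and minima of real-valued functions occurring below are written as suprema and infima
  of nonempty sets of reals; for submodular \<open>F\<close> with \<open>F {} = 0\<close> and strongly convex \<open>g\<close>
  they are attained.
\<close>

definition submodular :: "('n set \<Rightarrow> real) \<Rightarrow> bool" where
  "submodular F \<longleftrightarrow> (\<forall>A B. F A + F B \<ge> F (A \<union> B) + F (A \<inter> B))"

definition base_polytope :: "('n::finite set \<Rightarrow> real) \<Rightarrow> (real^'n) set" where
  "base_polytope F =
    {w. (\<forall>A. (\<Sum>k\<in>A. w $ k) \<le> F A) \<and> (\<Sum>k\<in>UNIV. w $ k) = F UNIV}"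

definition vert :: "'a::euclidean_space set \<Rightarrow> 'a set" where
  "vert P = {v. v extreme_point_of P}"

definition lovasz_extension :: "('n::finite set \<Rightarrow> real) \<Rightarrow> real^'n \<Rightarrow> real" where
  "lovasz_extension F x = (SUP w\<in>base_polytope F. w \<bullet> x)"

definition strongly_convex :: "real \<Rightarrow> ('a::real_normed_vector \<Rightarrow> real) \<Rightarrow> bool" where
  "strongly_convex \<beta> g \<longleftrightarrow> \<beta> > 0 \<and> convex_on UNIV (\<lambda>x. g x - \<beta> / 2 * (norm x)\<^sup>2)"

definition smooth_fun :: "real \<Rightarrow> ('a::real_normed_vector \<Rightarrow> real) \<Rightarrow> bool" where
  "smooth_fun \<alpha> g \<longleftrightarrow> \<alpha> > 0 \<and> concave_on UNIV (\<lambda>x. g x - \<alpha> / 2 * (norm x)\<^sup>2)"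

definition primal_opt :: "(real^'n \<Rightarrow> real) \<Rightarrow> ('n::finite set \<Rightarrow> real) \<Rightarrow> real" where
  "primal_opt g F = (INF x. g x + lovasz_extension F x)"

text \<open>
  A run of the simplicial method is given by sequences \<open>V\<close>, \<open>x\<close>, \<open>v\<close>, where \<open>V 0\<close> is the
  initial set of vertices and \<open>x i\<close>, \<open>v i\<close>, \<open>V i\<close> for \<open>i \<ge> 1\<close> belong to iteration \<open>i\<close>.
  Iteration \<open>i\<close> is performed iff the stopping test failed in every earlier iteration; the sequences
  are unconstrained beyond the iterations performed, so terminating runs are covered.
\<close>

definition osm_f :: "(nat \<Rightarrow> (real^'n::finite) set) \<Rightarrow> nat \<Rightarrow> real^'n \<Rightarrow> real" where
  "osm_f V i y = (SUP w\<in>V (i - 1). w \<bullet> y)"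

definition osm_p ::
  "(real^'n \<Rightarrow> real) \<Rightarrow> ('n::finite set \<Rightarrow> real) \<Rightarrow> (nat \<Rightarrow> real^'n) \<Rightarrow> nat \<Rightarrow> real" where
  "osm_p g F x i = g (x i) + lovasz_extension F (x i)"

definition osm_d ::
  "(real^'n::finite \<Rightarrow> real) \<Rightarrow> (nat \<Rightarrow> (real^'n) set) \<Rightarrow> (nat \<Rightarrow> real^'n) \<Rightarrow> nat \<Rightarrow> real" where
  "osm_d g V x i = g (x i) + osm_f V i (x i)"

definition osm_stops ::
  "(real^'n \<Rightarrow> real) \<Rightarrow> ('n::finite set \<Rightarrow> real) \<Rightarrow> real \<Rightarrow>
    (nat \<Rightarrow> (real^'n) set) \<Rightarrow> (nat \<Rightarrow> real^'n) \<Rightarrow> nat \<Rightarrow> bool" where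
  "osm_stops g F \<epsilon> V x i \<longleftrightarrow> osm_p g F x i - osm_d g V x i \<le> \<epsilon>"

definition osm_performed ::
  "(real^'n \<Rightarrow> real) \<Rightarrow> ('n::finite set \<Rightarrow> real) \<Rightarrow> real \<Rightarrow>
    (nat \<Rightarrow> (real^'n) set) \<Rightarrow> (nat \<Rightarrow> real^'n) \<Rightarrow> nat \<Rightarrow> bool" where
  "osm_performed g F \<epsilon> V x i \<longleftrightarrow> i \<ge> 1 \<and> (\<forall>j\<in>{1..<i}. \<not> osm_stops g F \<epsilon> V x j)"

definition osm_run ::
  "(real^'n \<Rightarrow> real) \<Rightarrow> ('n::finite set \<Rightarrow> real) \<Rightarrow> real \<Rightarrow>
    (nat \<Rightarrow> (real^'n) set) \<Rightarrow> (nat \<Rightarrow> real^'n) \<Rightarrow> (nat \<Rightarrow> real^'n) \<Rightarrow> bool" where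
  "osm_run g F \<epsilon> V x v \<longleftrightarrow>
    V 0 \<noteq> {} \<and> V 0 \<subseteq> vert (base_polytope F) \<and>
    (\<forall>i. osm_performed g F \<epsilon> V x i \<longrightarrow>
       is_arg_min (\<lambda>y. g y + osm_f V i y) (\<lambda>y. True) (x i) \<and>
       v i \<in> vert (base_polytope F) \<and>
       is_arg_max (\<lambda>w. w \<bullet> x i) (\<lambda>w. w \<in> base_polytope F) (v i) \<and>
       (\<not> osm_stops g F \<epsilon> V x i \<longrightarrow> V i = V (i - 1) \<union> {v i}))"

definition dirW :: "'a::euclidean_space set \<Rightarrow> 'a \<Rightarrow> real" where
  "dirW P x = (SUP (v, w)\<in>P \<times> P. (v - w) \<bullet> x / norm x)"

definition active_sets :: "'a::euclidean_space set \<Rightarrow> 'a \<Rightarrow> 'a set set" where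
  "active_sets V w =
    {A. A \<subseteq> V \<and> (\<exists>u. (\<forall>a\<in>A. u a > 0) \<and> sum u A = 1 \<and> (\<Sum>a\<in>A. u a *\<^sub>R a) = w)}"

definition PdirW :: "'a::euclidean_space set \<Rightarrow> 'a \<Rightarrow> 'a \<Rightarrow> real" where
  "PdirW V x w = (INF A\<in>active_sets V w. dirW (A \<union> {ARG_MAX (\<lambda>v. v \<bullet> x) v. v \<in> V}) x)"

text \<open>
  The minimum over \<open>K\<close>, \<open>w\<close>, \<open>x\<close> is taken jointly: if \<open>K\<close> is a single vertex there is no admissible
  direction \<open>x\<close>, and such a face must not contribute (a nested infimum would involve
  \<open>Inf {}\<close>, which is unspecified on the reals). If \<open>P\<close> is a single point, no face contributes and
  the value is meaningless.
\<close>

definition PWidth :: "'a::euclidean_space set \<Rightarrow> real" where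
  "PWidth P =
    Inf {PdirW (K \<inter> vert P) x w | K w x.
           K face_of P \<and> w \<in> K \<and> x \<in> cone hull ((\<lambda>k. k - w) ` K) - {0}}"

end

theory Submission
  imports Defs
begin

text \<open>
  Each iterate \<open>x i\<close> minimizes \<open>g y + w \<bullet> y\<close> for a maximizer \<open>w\<close>, over the convex hull of the current
  vertices, of the concave dual function \<open>w \<mapsto> min\<^sub>y (g y + w \<bullet> y)\<close>. By strong convexity this function
  stays above its linearization up to a quadratic term, so moving \<open>w\<close> towards the new vertex by a
  fraction \<open>t\<close> increases it by at least \<open>t G - t\<^sup>2 M\<^sup>2 / (2 \<beta>)\<close>, where \<open>G\<close> is the duality gap.
  Choosing \<open>t\<close> gives the gap bounds, since the dual function never exceeds the primal optimum on the
  base polytope.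

  If \<open>g\<close> is smooth, the dual function is strongly concave, which bounds the suboptimality by the square
  of the slope in the direction of the dual optimum. Because \<open>w\<close> is optimal for the current vertices,
  all active vertices attain the same inner product with \<open>x i\<close> as \<open>w\<close>, so \<open>G\<close> is a directional width
  of the active set together with the new vertex; the pyramidal width compares it with that slope.
\<close>

subsection \<open>Strongly convex functions and their concave dual\<close>

text \<open>Let \<open>t\<close> tend to 0. First-order conditions are extracted this way below,
  from inequalities whose error is of second order in \<open>t\<close>.\<close>

lemma nonpos_if_le_linear:
  fixes a K :: real
  assumes "\<And>t. 0 < t \<Longrightarrow> t \<le> 1 \<Longrightarrow> a \<le> t * K"
  shows "a \<le> 0"
proof (rule ccontr)
  assume a: "\<not> a \<le> 0"
  define B where "B = 2 * (\<bar>K\<bar> + 1)"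
  define t where "t = min 1 (a / B)"
  have B: "B > 0" unfolding B_def by simp
  have t: "0 < t" "t \<le> 1" using a B by (auto simp: t_def)
  have "t * B \<le> a / B * B" using B by (intro mult_right_mono) (auto simp: t_def)
  then have tB: "t * (2 * (\<bar>K\<bar> + 1)) \<le> a" using B unfolding B_def[symmetric] by simp
  have "t * K \<le> t * \<bar>K\<bar>" using t by (simp add: mult_left_mono)
  also have "\<dots> < t * (2 * (\<bar>K\<bar> + 1))" using t by (simp add: mult_strict_left_mono)
  finally show False using assms[of t] t tB by linarith
qed

lemma convex_line:
  fixes w y :: "'a::real_vector"
  assumes "convex S" "w \<in> S" "y \<in> S" "0 \<le> t" "t \<le> 1"
  shows "w + t *\<^sub>R (y - w) \<in> S"
proof -
  have "w + t *\<^sub>R (y - w) = (1 - t) *\<^sub>R w + t *\<^sub>R y" by (simp add: algebra_simps)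
  then show ?thesis using convexD[OF assms(1-3), of "1 - t" t] assms by simp
qed

lemma convex_on_line:
  fixes k :: "'a::real_vector \<Rightarrow> real"
  assumes "convex_on UNIV k" "0 \<le> t" "t \<le> 1"
  shows "k (y + t *\<^sub>R (z - y)) \<le> (1 - t) * k y + t * k z"
proof -
  have "y + t *\<^sub>R (z - y) = (1 - t) *\<^sub>R y + t *\<^sub>R z" by (simp add: algebra_simps)
  then show ?thesis using convex_onD[OF assms(1), of t y z] assms by simp
qed

text \<open>On the segment from \<open>y\<close> to \<open>z\<close>, convexity would turn a smaller
  value at \<open>z\<close> into a decrease linear in \<open>t\<close>, while the hypothesis allows
  only one of order \<open>t\<^sup>2\<close>.\<close>

lemma convex_minimum_lower_quadratic:
  fixes k :: "'a::real_normed_vector \<Rightarrow> real"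
  assumes "convex_on UNIV k" and low: "\<And>z. k z \<ge> k y - C * (norm (z - y))\<^sup>2"
  shows "k z \<ge> k y"
proof -
  have "k y - k z \<le> t * (C * (norm (z - y))\<^sup>2)" if t: "0 < t" "t \<le> 1" for t
  proof -
    have "k y - C * (norm (t *\<^sub>R (z - y)))\<^sup>2 \<le> k (y + t *\<^sub>R (z - y))"
      using low[of "y + t *\<^sub>R (z - y)"] by simp
    also have "\<dots> \<le> (1 - t) * k y + t * k z"
      using convex_on_line[OF assms(1)] t by simp
    finally have "t * (k y - k z) \<le> C * (norm (t *\<^sub>R (z - y)))\<^sup>2"
      by (simp add: algebra_simps)
    also have "\<dots> = t * (t * (C * (norm (z - y))\<^sup>2))"
      by (simp add: power2_eq_square)
    finally show ?thesis using t(1) by (rule mult_left_le_imp_le)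
  qed
  then have "k y - k z \<le> 0" by (rule nonpos_if_le_linear)
  then show ?thesis by simp
qed

text \<open>Reflecting \<open>z\<close> through \<open>y\<close> and using midpoint convexity turns
  the upper bound at the reflected point into the lower bound of the preceding lemma at
  \<open>z\<close>.\<close>

lemma convex_minimum_upper_quadratic:
  fixes k :: "'a::real_normed_vector \<Rightarrow> real"
  assumes "convex_on UNIV k" and up: "\<And>z. k z \<le> k y + C * (norm (z - y))\<^sup>2"
  shows "k z \<ge> k y"
proof (rule convex_minimum_lower_quadratic[OF assms(1)])
  fix z
  define z' where "z' = y - (z - y)"
  have mid: "z' + (1/2) *\<^sub>R (z - z') = y"
  proof -
    have "z - z' = 2 *\<^sub>R (z - y)" unfolding z'_def by (simp add: scaleR_2)
    then show ?thesis unfolding z'_def by simp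
  qed
  have "k y \<le> k z' / 2 + k z / 2"
    using convex_on_line[OF assms(1), of "1/2" z' z] unfolding mid by simp
  moreover have "norm (z' - y) = norm (z - y)"
    unfolding z'_def by (simp add: norm_minus_commute)
  then have "k z' \<le> k y + C * (norm (z - y))\<^sup>2"
    using up[of z'] by simp
  ultimately show "k z \<ge> k y - C * (norm (z - y))\<^sup>2" by linarith
qed

text \<open>Moving the centre of the quadratic from 0 to \<open>y\<close> changes it only by an
  affine function, so convexity and concavity are preserved.\<close>

lemma affine_minus_quadratic_shift:
  fixes w y z :: "'a::real_inner"
  shows "g z - c / 2 * (norm z)\<^sup>2 + (w + c *\<^sub>R y) \<bullet> z - c / 2 * (norm y)\<^sup>2
           = g z + w \<bullet> z - c / 2 * (norm (z - y))\<^sup>2"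
  by (simp add: power2_norm_eq_inner inner_diff inner_add inner_commute algebra_simps)

lemma convex_on_add_inner:
  fixes k :: "'a::real_inner \<Rightarrow> real"
  assumes "convex_on UNIV k"
  shows "convex_on UNIV (\<lambda>z. k z + w \<bullet> z - c)"
proof -
  have "convex_on UNIV (\<lambda>z. w \<bullet> z - c)"
    by (intro convex_onI) (auto simp: inner_add algebra_simps)
  from convex_on_add[OF assms this] show ?thesis by (simp add: algebra_simps)
qed

lemma strongly_convex_shift:
  fixes g :: "'a::real_inner \<Rightarrow> real"
  assumes "strongly_convex \<beta> g"
  shows "convex_on UNIV (\<lambda>z. g z + w \<bullet> z - \<beta> / 2 * (norm (z - y))\<^sup>2)"
  using assms convex_on_add_inner[of "\<lambda>x. g x - \<beta> / 2 * (norm x)\<^sup>2" "w + \<beta> *\<^sub>R y" "\<beta> / 2 * (norm y)\<^sup>2"]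
  unfolding strongly_convex_def affine_minus_quadratic_shift by simp

lemma smooth_shift:
  fixes g :: "'a::real_inner \<Rightarrow> real"
  assumes "smooth_fun \<alpha> g"
  shows "convex_on UNIV (\<lambda>z. - (g z + w \<bullet> z - \<alpha> / 2 * (norm (z - y))\<^sup>2))"
proof -
  have "convex_on UNIV (\<lambda>x. - (g x - \<alpha> / 2 * (norm x)\<^sup>2))"
    using assms unfolding smooth_fun_def concave_on_def by simp
  from convex_on_add_inner[OF this, of "- (w + \<alpha> *\<^sub>R y)" "- (\<alpha> / 2 * (norm y)\<^sup>2)"]
  moreover have "- (g z - \<alpha> / 2 * (norm z)\<^sup>2) + (- (w + \<alpha> *\<^sub>R y)) \<bullet> z - - (\<alpha> / 2 * (norm y)\<^sup>2)
      = - (g z + w \<bullet> z - \<alpha> / 2 * (norm (z - y))\<^sup>2)" for z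
    unfolding affine_minus_quadratic_shift[symmetric, of g z w \<alpha> y]
    by (simp add: inner_add_left inner_diff_left)
  ultimately show ?thesis by (simp only:)
qed

text \<open>After the quadratic centred at \<open>y\<close> is subtracted, the function is still
  convex, and \<open>y\<close> still minimizes it up to a quadratic error, hence exactly.\<close>

lemma strongly_convex_at_minimum:
  fixes g :: "'a::real_inner \<Rightarrow> real"
  assumes "strongly_convex \<beta> g" and min: "\<And>z. g y + w \<bullet> y \<le> g z + w \<bullet> z"
  shows "g y + w \<bullet> y + \<beta> / 2 * (norm (z - y))\<^sup>2 \<le> g z + w \<bullet> z"
  using convex_minimum_lower_quadratic[OF strongly_convex_shift[OF assms(1), of w y], of y "\<beta> / 2" z] min
  by simp

text \<open>Here the function minus its quadratic is concave. Minimality of \<open>y\<close> bounds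
  the negation from above, so \<open>y\<close> maximizes the concave function.\<close>

lemma smooth_at_minimum:
  fixes g :: "'a::real_inner \<Rightarrow> real"
  assumes "smooth_fun \<alpha> g" and min: "\<And>z. g y + w \<bullet> y \<le> g z + w \<bullet> z"
  shows "g z + w \<bullet> z \<le> g y + w \<bullet> y + \<alpha> / 2 * (norm (z - y))\<^sup>2"
proof -
  have up: "- (g z + w \<bullet> z - \<alpha> / 2 * (norm (z - y))\<^sup>2)
      \<le> - (g y + w \<bullet> y - \<alpha> / 2 * (norm (y - y))\<^sup>2) + \<alpha> / 2 * (norm (z - y))\<^sup>2" for z
    using min[of z] by simp
  show ?thesis
    using convex_minimum_upper_quadratic[OF smooth_shift[OF assms(1), of w y] up, of z] by simp
qed

text \<open>The convex part \<open>k\<close> falls at most linearly outside the unit ball, so the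
  quadratic dominates far away and the search reduces to a compact ball.\<close>

lemma strongly_convex_attains_min:
  fixes g :: "'a::euclidean_space \<Rightarrow> real"
  assumes "strongly_convex \<beta> g"
  shows "\<exists>y. \<forall>z. g y + w \<bullet> y \<le> g z + w \<bullet> z"
proof -
  have b: "\<beta> > 0" using assms unfolding strongly_convex_def by simp
  define k where "k = (\<lambda>z. g z + w \<bullet> z - \<beta> / 2 * (norm (z - 0))\<^sup>2)"
  have ck: "convex_on UNIV k" unfolding k_def by (rule strongly_convex_shift[OF assms])
  have contk: "continuous_on S k" for S
    using convex_on_continuous[OF open_UNIV ck] continuous_on_subset by blast
  obtain m where m: "\<And>z. z \<in> cball 0 1 \<Longrightarrow> k m \<le> k z"
    using continuous_attains_inf[of "cball 0 1" k] contk by force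
  define L where "L = k 0 - k m"
  have L: "L \<ge> 0" using m[of 0] unfolding L_def by simp
  have low: "k z \<ge> k 0 - L * norm z" if z: "norm z \<ge> 1" for z
  proof -
    have "z \<noteq> 0" using z by auto
    have "k 0 - L \<le> k (0 + (1 / norm z) *\<^sub>R (z - 0))" using m z unfolding L_def by auto
    also have "\<dots> \<le> (1 - 1 / norm z) * k 0 + 1 / norm z * k z"
      using convex_on_line[OF ck, of "1 / norm z" 0 z] z \<open>z \<noteq> 0\<close> by (simp add: divide_le_eq_1_pos)
    finally have "norm z * (k 0 - L) \<le> norm z * ((1 - 1 / norm z) * k 0 + 1 / norm z * k z)"
      using z by (intro mult_left_mono) auto
    moreover have "norm z * ((1 - 1 / norm z) * k 0 + 1 / norm z * k z) = (norm z - 1) * k 0 + k z"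
      using z by (cases "z = 0") (auto simp: field_simps)
    ultimately show ?thesis by (simp add: algebra_simps)
  qed
  define h where "h = (\<lambda>z. k z + \<beta> / 2 * (norm z)\<^sup>2)"
  have h: "h z = g z + w \<bullet> z" for z unfolding h_def k_def by simp
  \<comment> \<open>Beyond \<open>2 * L / \<beta>\<close> the quadratic outweighs
    \<open>L * norm z\<close>; the summand 1 puts \<open>z\<close> outside the unit ball, where
    \<open>low\<close> applies.\<close>
  define R where "R = 1 + 2 * L / \<beta>"
  have R: "R \<ge> 1" using L b unfolding R_def by simp
  have conth: "continuous_on (cball 0 R) h"
    unfolding h_def by (intro continuous_intros contk)
  obtain y where y: "y \<in> cball 0 R" "\<And>z. z \<in> cball 0 R \<Longrightarrow> h y \<le> h z"
    using continuous_attains_inf[OF compact_cball _ conth] R by force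
  have "h y \<le> h z" for z
  proof (cases "norm z \<le> R")
    case True then show ?thesis using y by simp
  next
    case False
    then have nz: "norm z \<ge> 1" "norm z \<ge> 2 * L / \<beta>" using R unfolding R_def by auto
    then have "L \<le> \<beta> / 2 * norm z" using b by (simp add: field_simps)
    then have "L * norm z \<le> \<beta> / 2 * (norm z)\<^sup>2"
      using nz mult_right_mono[of L "\<beta> / 2 * norm z" "norm z"] by (simp add: power2_eq_square)
    then have "h 0 \<le> h z" using low[OF nz(1)] unfolding h_def by simp
    then show ?thesis using y(2)[of 0] R by simp
  qed
  then show ?thesis unfolding h by blast
qed

section \<open>The dual function and its first-order bounds\<close>

text \<open>For strongly convex \<open>g\<close> the minimizer exists and is unique by quadratic
  growth. It is the gradient of \<open>dual_value g\<close> at \<open>w\<close>, as the upper and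
  lower bounds below show.\<close>

definition dual_argmin :: "('a::real_inner \<Rightarrow> real) \<Rightarrow> 'a \<Rightarrow> 'a" where
  "dual_argmin g w = (SOME y. \<forall>z. g y + w \<bullet> y \<le> g z + w \<bullet> z)"

text \<open>In terms of the Fenchel conjugate, this is \<open>- g\<^sup>*(- w)\<close>.\<close>

definition dual_value :: "('a::real_inner \<Rightarrow> real) \<Rightarrow> 'a \<Rightarrow> real" where
  "dual_value g w = g (dual_argmin g w) + w \<bullet> dual_argmin g w"

context
  fixes \<beta> :: real and g :: "'a::euclidean_space \<Rightarrow> real"
  assumes g: "strongly_convex \<beta> g"
begin

lemma dual_value_le: "dual_value g w \<le> g z + w \<bullet> z"
  using someI_ex[OF strongly_convex_attains_min[OF g, of w]]
  unfolding dual_value_def dual_argmin_def by blast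

lemma dual_value_quadratic:
  "dual_value g w + \<beta> / 2 * (norm (z - dual_argmin g w))\<^sup>2 \<le> g z + w \<bullet> z"
  using strongly_convex_at_minimum[OF g, of "dual_argmin g w" w] dual_value_le[of w]
  unfolding dual_value_def by simp

text \<open>Concavity of the dual function: the minimizer for \<open>w\<close> is a trial point for
  \<open>w'\<close>.\<close>

lemma dual_value_upper:
  "dual_value g w' \<le> dual_value g w + (w' - w) \<bullet> dual_argmin g w"
  using dual_value_le[of w' "dual_argmin g w"] unfolding dual_value_def by (simp add: inner_diff)

text \<open>Strong convexity of \<open>g\<close> makes its dual smooth with constant
  \<open>1 / \<beta>\<close>. Quadratic growth at \<open>w\<close> is evaluated at the minimizer for
  \<open>w'\<close>, and completing the square removes the displacement \<open>?u\<close>.\<close>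

lemma dual_value_lower:
  "dual_value g w + (w' - w) \<bullet> dual_argmin g w - (norm (w' - w))\<^sup>2 / (2 * \<beta>) \<le> dual_value g w'"
proof -
  have b: "\<beta> > 0" using g unfolding strongly_convex_def by simp
  let ?u = "dual_argmin g w' - dual_argmin g w"
  have "0 \<le> (norm (\<beta> *\<^sub>R ?u + (w' - w)))\<^sup>2 / (2 * \<beta>)" using b by simp
  also have "\<dots> = \<beta> / 2 * (norm ?u)\<^sup>2 + (w' - w) \<bullet> ?u + (norm (w' - w))\<^sup>2 / (2 * \<beta>)"
    unfolding power2_norm_eq_inner inner_add_left inner_add_right inner_scaleR_left inner_scaleR_right
      inner_commute[of ?u "w' - w"]
    using b by (simp add: field_simps)
  also have "(w' - w) \<bullet> ?u = w' \<bullet> dual_argmin g w' - w \<bullet> dual_argmin g w' - (w' - w) \<bullet> dual_argmin g w"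
    by (simp add: inner_diff)
  finally show ?thesis
    using dual_value_quadratic[of w "dual_argmin g w'"] unfolding dual_value_def[of g w'] by simp
qed

lemma dual_value_upper_smooth:
  assumes a: "smooth_fun \<alpha> g"
  shows "dual_value g w' \<le> dual_value g w + (w' - w) \<bullet> dual_argmin g w - (norm (w' - w))\<^sup>2 / (2 * \<alpha>)"
proof -
  have pos: "\<alpha> > 0" using a unfolding smooth_fun_def by simp
  \<comment> \<open>This point minimizes the quadratic upper model of
    \<open>g z + w' \<bullet> z\<close> that smoothness provides around
    \<open>dual_argmin g w\<close>.\<close>
  define z where "z = dual_argmin g w - (1 / \<alpha>) *\<^sub>R (w' - w)"
  have "g z + w \<bullet> z \<le> dual_value g w + \<alpha> / 2 * (norm (z - dual_argmin g w))\<^sup>2"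
    unfolding dual_value_def
    by (rule smooth_at_minimum[OF a]) (use dual_value_le in \<open>simp add: dual_value_def\<close>)
  moreover have "\<alpha> / 2 * (norm (z - dual_argmin g w))\<^sup>2 = (norm (w' - w))\<^sup>2 / (2 * \<alpha>)"
    using pos by (simp add: z_def power_divide power2_eq_square)
  moreover have "(w' - w) \<bullet> z = (w' - w) \<bullet> dual_argmin g w - (norm (w' - w))\<^sup>2 / \<alpha>"
    by (simp add: z_def inner_diff_right power2_norm_eq_inner)
  moreover have "(norm (w' - w))\<^sup>2 / \<alpha> = 2 * ((norm (w' - w))\<^sup>2 / (2 * \<alpha>))" by simp
  ultimately show ?thesis
    using dual_value_le[of w' z] inner_diff_left[of w' w z] by linarith
qed

text \<open>Both quadratic bounds are compared at unit distance from a common minimizer. The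
  inequality keeps the rate below 1.\<close>

lemma strongly_convex_le_smooth:
  assumes a: "smooth_fun \<alpha> g"
  shows "\<beta> \<le> \<alpha>"
proof -
  obtain e :: 'a where e: "e \<in> Basis" using nonempty_Basis by blast
  define y where "y = dual_argmin g 0"
  have "g (y + e) + 0 \<bullet> (y + e) \<le> g y + 0 \<bullet> y + \<alpha> / 2 * (norm (y + e - y))\<^sup>2"
    by (rule smooth_at_minimum[OF a])
       (use dual_value_le[of 0] in \<open>simp add: dual_value_def y_def\<close>)
  moreover have "g y + 0 \<bullet> y + \<beta> / 2 * (norm (y + e - y))\<^sup>2 \<le> g (y + e) + 0 \<bullet> (y + e)"
    using dual_value_quadratic[of 0 "y + e"] by (simp add: dual_value_def y_def)
  ultimately show ?thesis using e by simp
qed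

lemma continuous_on_dual_value: "continuous_on S (dual_value g)"
proof -
  have "isCont (dual_value g) w" for w
  proof -
    have "((\<lambda>w'. dual_value g w + (w' - w) \<bullet> dual_argmin g w - (norm (w' - w))\<^sup>2 / (2 * \<beta>))
        \<longlongrightarrow> dual_value g w + (w - w) \<bullet> dual_argmin g w - (norm (w - w))\<^sup>2 / (2 * \<beta>)) (at w)"
      by (intro tendsto_intros) (use g in \<open>auto simp: strongly_convex_def\<close>)
    moreover have "((\<lambda>w'. dual_value g w + (w' - w) \<bullet> dual_argmin g w)
        \<longlongrightarrow> dual_value g w + (w - w) \<bullet> dual_argmin g w) (at w)"
      by (intro tendsto_intros)
    ultimately have "(dual_value g \<longlongrightarrow> dual_value g w) (at w)"
      using tendsto_sandwich[where f = "\<lambda>w'. dual_value g w + (w' - w) \<bullet> dual_argmin g w - (norm (w' - w))\<^sup>2 / (2 * \<beta>)"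
          and g = "dual_value g" and h = "\<lambda>w'. dual_value g w + (w' - w) \<bullet> dual_argmin g w"
          and net = "at w"] dual_value_lower dual_value_upper
      by simp
    then show ?thesis unfolding isCont_def .
  qed
  then show ?thesis by (simp add: continuous_at_imp_continuous_on)
qed

text \<open>A maximizer of the dual function over \<open>C\<close> and its argument minimum form a saddle point; this
  replaces the minimax theorem.\<close>

lemma dual_value_saddle:
  assumes "compact C" "convex C" "C \<noteq> {}"
  shows "\<exists>w\<in>C. \<forall>c\<in>C. c \<bullet> dual_argmin g w \<le> w \<bullet> dual_argmin g w"
proof -
  obtain w where w: "w \<in> C" "\<And>c. c \<in> C \<Longrightarrow> dual_value g c \<le> dual_value g w"
    using continuous_attains_sup[OF assms(1,3) continuous_on_dual_value] by blast
  \<comment> \<open>A step \<open>t\<close> towards \<open>c\<close> gains \<open>t\<close> times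
    this slope up to an error of order \<open>t\<^sup>2\<close>, but no gain is possible at a
    maximizer.\<close>
  have "(c - w) \<bullet> dual_argmin g w \<le> 0" if c: "c \<in> C" for c
  proof (rule nonpos_if_le_linear)
    fix t :: real assume t: "0 < t" "t \<le> 1"
    have "w + t *\<^sub>R (c - w) \<in> C"
      using t by (intro convex_line[OF assms(2) w(1) c]) auto
    from w(2)[OF this] dual_value_lower[of w "w + t *\<^sub>R (c - w)"]
    have "t * ((c - w) \<bullet> dual_argmin g w) \<le> (norm (t *\<^sub>R (c - w)))\<^sup>2 / (2 * \<beta>)"
      by simp
    also have "\<dots> = t * (t * ((norm (c - w))\<^sup>2 / (2 * \<beta>)))"
      by (simp add: power2_eq_square)
    finally have "t * ((c - w) \<bullet> dual_argmin g w) \<le> t * (t * ((norm (c - w))\<^sup>2 / (2 * \<beta>)))" .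
    then show "(c - w) \<bullet> dual_argmin g w \<le> t * ((norm (c - w))\<^sup>2 / (2 * \<beta>))"
      using t(1) by (rule mult_left_le_imp_le)
  qed
  then show ?thesis using w(1) by (auto simp: inner_diff)
qed

end

section \<open>Minimizers for finitely many vertices\<close>

lemma inner_le_on_convex_hull:
  assumes "\<And>u. u \<in> V \<Longrightarrow> u \<bullet> y \<le> b" "c \<in> convex hull V"
  shows "c \<bullet> y \<le> b"
proof -
  have "convex hull V \<subseteq> {c. y \<bullet> c \<le> b}"
    using assms(1) by (intro hull_minimal convex_halfspace_le) (auto simp: inner_commute)
  then show ?thesis using assms(2) by (auto simp: inner_commute)
qed

text \<open>A saddle point \<open>w\<close> over the hull makes the objective at
  \<open>dual_argmin g w\<close> equal to \<open>dual_value g w\<close>. Quadratic growth then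
  forces the given minimizer \<open>y\<close> to coincide with that point.\<close>

lemma restricted_minimizer:
  fixes g :: "'a::euclidean_space \<Rightarrow> real"
  assumes g: "strongly_convex \<beta> g" and V: "finite V" "V \<noteq> {}"
    and y: "is_arg_min (\<lambda>y. g y + (SUP w\<in>V. w \<bullet> y)) (\<lambda>y. True) y"
  obtains w where "w \<in> convex hull V" "y = dual_argmin g w"
    "\<And>c. c \<in> convex hull V \<Longrightarrow> c \<bullet> y \<le> w \<bullet> y"
    "g y + (SUP w\<in>V. w \<bullet> y) = dual_value g w"
proof -
  have b: "\<beta> > 0" using g unfolding strongly_convex_def by simp
  have up: "c \<bullet> z \<le> (SUP w\<in>V. w \<bullet> z)" if "c \<in> convex hull V" for c z
    using that by (rule inner_le_on_convex_hull[rotated]) (intro cSUP_upper bdd_above_finite finite_imageI V)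
  obtain w where w: "w \<in> convex hull V"
      "\<And>c. c \<in> convex hull V \<Longrightarrow> c \<bullet> dual_argmin g w \<le> w \<bullet> dual_argmin g w"
    using dual_value_saddle[OF g, of "convex hull V"] V by (auto simp: finite_imp_compact_convex_hull)
  have sup: "(SUP u\<in>V. u \<bullet> dual_argmin g w) = w \<bullet> dual_argmin g w"
    by (intro antisym cSUP_least up V w) (simp add: hull_inc)
  have "g y + (SUP w\<in>V. w \<bullet> y) \<le> dual_value g w"
    using y sup unfolding is_arg_min_linorder dual_value_def by metis
  then have "\<beta> / 2 * (norm (y - dual_argmin g w))\<^sup>2 \<le> 0"
    using dual_value_quadratic[OF g, of w y] up[OF w(1), of y] by linarith
  then have "y = dual_argmin g w" using b by (simp add: mult_le_0_iff)
  then show ?thesis using that w sup by (simp add: dual_value_def)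
qed

subsection \<open>Positivity of the pyramidal width\<close>

text \<open>A nonzero \<open>x\<close> in the cone has positive inner product with some generator,
  since otherwise \<open>x \<bullet> x \<le> 0\<close>. A finitely generated cone is closed, so
  compactness of its unit sphere makes this uniform.\<close>

lemma convex_cone_hull_uniform_ascent:
  fixes D :: "'a::euclidean_space set"
  assumes "finite D"
  shows "\<exists>e>0. \<forall>x\<in>convex_cone hull D. x \<noteq> 0 \<longrightarrow> (\<exists>d\<in>D. d \<bullet> x \<ge> e * norm x)"
proof -
  define S where "S = sphere 0 1 \<inter> convex_cone hull D"
  have S: "compact S" unfolding S_def
    by (intro compact_Int_closed closed_convex_cone_hull assms) simp
  let ?h = "\<lambda>x. \<Sum>d\<in>D. max 0 (d \<bullet> x)"
  have pos: "?h x > 0" if x: "x \<in> S" for x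
  proof -
    have "\<exists>d\<in>D. d \<bullet> x > 0"
    proof (rule ccontr)
      assume "\<not> ?thesis"
      then have "convex_cone hull D \<subseteq> {y. x \<bullet> y \<le> 0}"
        by (intro hull_minimal) (auto simp: not_less inner_commute convex_cone_iff inner_add
            mult_le_0_iff)
      then have "x \<bullet> x \<le> 0" using x unfolding S_def by blast
      then show False using x unfolding S_def by (auto simp: dot_square_norm)
    qed
    then show ?thesis using assms by (auto intro!: sum_pos2)
  qed
  obtain m where m: "m > 0" "\<And>x. x \<in> S \<Longrightarrow> m \<le> ?h x"
  proof (cases "S = {}")
    case True then show ?thesis using that[of 1] by simp
  next
    case False
    have "continuous_on S ?h" by (intro continuous_intros)
    with continuous_attains_inf[OF S False] obtain x where "x \<in> S" "\<And>z. z \<in> S \<Longrightarrow> ?h x \<le> ?h z"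
      by blast
    then show ?thesis using that pos by blast
  qed
  \<comment> \<open>If every generator stayed below \<open>e\<close>, the sum would be less than
    \<open>m\<close>. The summand 1 makes this strict and covers an empty \<open>D\<close>.\<close>
  define e where "e = m / (real (card D) + 1)"
  have e: "e > 0" using m(1) unfolding e_def by (simp add: add_nonneg_pos)
  show ?thesis
  proof (intro exI[of _ e] conjI ballI impI e)
    fix x assume x: "x \<in> convex_cone hull D" "x \<noteq> 0"
    show "\<exists>d\<in>D. d \<bullet> x \<ge> e * norm x"
    proof (rule ccontr)
      assume n: "\<not> ?thesis"
      let ?u = "(1 / norm x) *\<^sub>R x"
      have "?u \<in> S" unfolding S_def using x convex_cone_hull_mul[of x D "1 / norm x"] by auto
      then have "m \<le> ?h ?u" by (rule m)
      also have "\<dots> \<le> (\<Sum>d\<in>D. e)"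
      proof (rule sum_mono)
        fix d assume "d \<in> D"
        then have "d \<bullet> x \<le> e * norm x" using n by force
        then show "max 0 (d \<bullet> ?u) \<le> e" using x e by (simp add: field_simps)
      qed
      also have "\<dots> = real (card D) * e" by simp
      also have "\<dots> < (real (card D) + 1) * e" using e by (simp add: mult_strict_right_mono)
      also have "\<dots> = m" unfolding e_def by (simp add: add_nonneg_eq_0_iff)
      finally show False by simp
    qed
  qed
qed

section \<open>Directional widths and active sets\<close>

lemma inner_diff_le_dirW:
  assumes "finite P" "v \<in> P" "w \<in> P"
  shows "(v - w) \<bullet> x / norm x \<le> dirW P x"
  unfolding dirW_def
  using cSUP_upper[of "(v, w)" "P \<times> P" "\<lambda>(v, w). (v - w) \<bullet> x / norm x"] assms by simp

lemma dirW_le: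
  assumes "P \<noteq> {}" "\<And>v w. v \<in> P \<Longrightarrow> w \<in> P \<Longrightarrow> (v - w) \<bullet> x / norm x \<le> b"
  shows "dirW P x \<le> b"
  unfolding dirW_def by (rule cSUP_least) (use assms in auto)

lemma arg_max_inner:
  fixes V :: "'a::euclidean_space set"
  assumes "finite V" "V \<noteq> {}"
  shows "(ARG_MAX (\<lambda>v. v \<bullet> x) v. v \<in> V) \<in> V"
    and "\<And>u. u \<in> V \<Longrightarrow> u \<bullet> x \<le> (ARG_MAX (\<lambda>v. v \<bullet> x) v. v \<in> V) \<bullet> x"
proof -
  obtain v where "v \<in> V" "v \<bullet> x = Max ((\<lambda>v. v \<bullet> x) ` V)"
    using Max_in[of "(\<lambda>v. v \<bullet> x) ` V"] assms by (metis finite_imageI image_iff image_is_empty)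
  then have "is_arg_max (\<lambda>v. v \<bullet> x) (\<lambda>v. v \<in> V) v"
    using assms by (simp add: is_arg_max_linorder)
  then have "is_arg_max (\<lambda>v. v \<bullet> x) (\<lambda>v. v \<in> V) (ARG_MAX (\<lambda>v. v \<bullet> x) v. v \<in> V)"
    unfolding arg_max_def by (rule someI)
  then show "(ARG_MAX (\<lambda>v. v \<bullet> x) v. v \<in> V) \<in> V"
    and "\<And>u. u \<in> V \<Longrightarrow> u \<bullet> x \<le> (ARG_MAX (\<lambda>v. v \<bullet> x) v. v \<in> V) \<bullet> x"
    by (auto simp: is_arg_max_linorder)
qed

lemma active_sets_nonempty:
  assumes "A \<in> active_sets V w"
  shows "A \<noteq> {}"
  using assms unfolding active_sets_def by auto

lemma finite_active_sets: "finite V \<Longrightarrow> finite (active_sets V w)"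
  by (rule finite_subset[of _ "Pow V"]) (auto simp: active_sets_def)

text \<open>The slacks \<open>(w - b) \<bullet> y\<close> are nonnegative and their combination with
  positive multipliers is 0, so each of them vanishes.\<close>

lemma active_sets_tight:
  assumes "A \<in> active_sets V w" "finite A" and le: "\<And>b. b \<in> A \<Longrightarrow> b \<bullet> y \<le> w \<bullet> y" and a: "a \<in> A"
  shows "a \<bullet> y = w \<bullet> y"
proof -
  obtain u where u: "\<forall>a\<in>A. u a > 0" "sum u A = 1" "(\<Sum>a\<in>A. u a *\<^sub>R a) = w"
    using assms(1) unfolding active_sets_def by blast
  have "(\<Sum>b\<in>A. u b * ((w - b) \<bullet> y)) = (\<Sum>b\<in>A. u b *\<^sub>R (w - b)) \<bullet> y"
    by (simp add: inner_sum_left)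
  also have "(\<Sum>b\<in>A. u b *\<^sub>R (w - b)) = 0"
    unfolding scaleR_diff_right sum_subtractf u(3) by (simp add: u(2) flip: scaleR_sum_left)
  finally have "(\<Sum>b\<in>A. u b * ((w - b) \<bullet> y)) = 0" by simp
  moreover have "0 \<le> u b * ((w - b) \<bullet> y)" if "b \<in> A" for b
    using that u(1) le[OF that]
    by (intro mult_nonneg_nonneg) (auto simp: inner_diff_left intro: less_imp_le)
  ultimately have "u a * ((w - a) \<bullet> y) = 0" using a assms(2) by (simp add: sum_nonneg_eq_0_iff)
  then show ?thesis using u(1) a by (auto simp: inner_diff_left)
qed

lemma active_sets_exist:
  assumes "finite V" "w \<in> convex hull V"
  shows "active_sets V w \<noteq> {}"
proof -
  obtain u where u: "\<forall>x\<in>V. 0 \<le> u x" "sum u V = 1" "(\<Sum>x\<in>V. u x *\<^sub>R x) = w"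
    using assms by (auto simp: convex_hull_finite)
  let ?A = "{a\<in>V. u a \<noteq> 0}"
  have "sum u ?A = 1" "(\<Sum>x\<in>?A. u x *\<^sub>R x) = w"
    unfolding u(2,3)[symmetric] by (rule sum.mono_neutral_left; use assms in auto)+
  moreover have "\<forall>a\<in>?A. u a > 0" using u(1) by (auto simp: less_le)
  ultimately have "?A \<in> active_sets V w" unfolding active_sets_def by blast
  then show ?thesis by blast
qed

lemma PdirW_le:
  assumes "finite V" "A \<in> active_sets V w"
  shows "PdirW V x w \<le> dirW (A \<union> {ARG_MAX (\<lambda>v. v \<bullet> x) v. v \<in> V}) x"
  unfolding PdirW_def
  by (intro cINF_lower bdd_below_finite finite_imageI finite_active_sets assms)

lemma vert_subset: "vert P \<subseteq> P"
  unfolding vert_def extreme_point_of_def by blast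

lemma vert_face: "K face_of P \<Longrightarrow> K \<inter> vert P = vert K"
  using extreme_point_of_face unfolding vert_def by blast

lemma polytope_convex_hull_vert:
  fixes P :: "'a::euclidean_space set"
  assumes "polytope P"
  shows "convex hull (vert P) = P"
  unfolding vert_def
  using Krein_Milman_Minkowski[OF polytope_imp_compact[OF assms] polytope_imp_convex[OF assms]]
  by simp

lemma finite_vert:
  fixes P :: "'a::euclidean_space set"
  assumes "polytope P"
  shows "finite (vert P)"
  unfolding vert_def
  using finite_polyhedron_extreme_points polytope_imp_polyhedron assms by blast

text \<open>Expanding both points writes \<open>k - w\<close> as a convex combination of differences
  \<open>q - a\<close>. These generators do not mention \<open>w\<close>, so only finitely many
  cones arise for a polytope.\<close>

lemma cone_hull_translate_subset:
  fixes Q A :: "'a::euclidean_space set"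
  assumes "finite Q" "finite A" "w \<in> convex hull A"
  shows "cone hull ((\<lambda>k. k - w) ` (convex hull Q)) \<subseteq> convex_cone hull ((\<lambda>(q, a). q - a) ` (Q \<times> A))"
    (is "_ \<subseteq> ?C")
proof
  fix x assume "x \<in> cone hull ((\<lambda>k. k - w) ` (convex hull Q))"
  then obtain c k where x: "x = c *\<^sub>R (k - w)" "c \<ge> 0" "k \<in> convex hull Q"
    by (auto simp: cone_hull_expl)
  obtain s where s: "\<forall>q\<in>Q. 0 \<le> s q" "sum s Q = 1" "(\<Sum>q\<in>Q. s q *\<^sub>R q) = k"
    using x(3) assms(1) by (auto simp: convex_hull_finite)
  obtain u where u: "\<forall>a\<in>A. 0 \<le> u a" "sum u A = 1" "(\<Sum>a\<in>A. u a *\<^sub>R a) = w"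
    using assms(2,3) by (auto simp: convex_hull_finite)
  have C: "convex ?C" by (rule convex_convex_cone_hull)
  have qw: "q - w \<in> ?C" if q: "q \<in> Q" for q
  proof -
    have "(\<Sum>a\<in>A. u a *\<^sub>R (q - a)) \<in> ?C"
      using u q by (intro convex_sum[OF assms(2) C] hull_inc) auto
    moreover have "(\<Sum>a\<in>A. u a *\<^sub>R (q - a)) = q - w"
      unfolding scaleR_diff_right sum_subtractf u(3) by (simp add: u(2) flip: scaleR_sum_left)
    ultimately show ?thesis by simp
  qed
  have "(\<Sum>q\<in>Q. s q *\<^sub>R (q - w)) \<in> ?C"
    using s qw by (intro convex_sum[OF assms(1) C]) auto
  moreover have "(\<Sum>q\<in>Q. s q *\<^sub>R (q - w)) = k - w"
    unfolding scaleR_diff_right sum_subtractf s(3) by (simp add: s(2) flip: scaleR_sum_left)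
  ultimately show "x \<in> ?C" using x convex_cone_hull_mul by auto
qed

text \<open>There are infinitely many points and directions but only finitely many pairs of vertex
  sets \<open>(Q, A)\<close>; the least of their ascent constants works for all.\<close>

lemma PdirW_uniform_lower_bound:
  fixes P :: "'a::euclidean_space set"
  assumes P: "polytope P"
  obtains e where "e > 0"
    "\<And>K w x. K face_of P \<Longrightarrow> w \<in> K \<Longrightarrow> x \<in> cone hull ((\<lambda>k. k - w) ` K) - {0} \<Longrightarrow>
       e \<le> PdirW (K \<inter> vert P) x w"
proof -
  define D where "D = (\<lambda>(Q, A). (\<lambda>(q, a). q - a) ` (Q \<times> A :: ('a \<times> 'a) set))"
  define I where "I = Pow (vert P) \<times> Pow (vert P)"
  have fin: "finite (vert P)" by (rule finite_vert[OF P])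
  have fI: "finite I" "I \<noteq> {}" unfolding I_def using fin by auto
  have "\<forall>J\<in>I. \<exists>e>0. \<forall>x\<in>convex_cone hull (D J). x \<noteq> 0 \<longrightarrow> (\<exists>d\<in>D J. d \<bullet> x \<ge> e * norm x)"
  proof
    fix J assume "J \<in> I"
    then have "finite (D J)" using fin unfolding D_def I_def by (auto intro: finite_subset)
    then show "\<exists>e>0. \<forall>x\<in>convex_cone hull (D J). x \<noteq> 0 \<longrightarrow> (\<exists>d\<in>D J. d \<bullet> x \<ge> e * norm x)"
      by (rule convex_cone_hull_uniform_ascent)
  qed
  then obtain E where E: "\<And>J. J \<in> I \<Longrightarrow> E J > (0::real)"
    "\<And>J x. J \<in> I \<Longrightarrow> x \<in> convex_cone hull (D J) \<Longrightarrow> x \<noteq> 0 \<Longrightarrow> \<exists>d\<in>D J. d \<bullet> x \<ge> E J * norm x"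
    by metis
  define e where "e = Min (E ` I)"
  have e: "e > 0" "\<And>J. J \<in> I \<Longrightarrow> e \<le> E J"
    unfolding e_def using fI E(1) by auto
  show ?thesis
  proof (rule that[OF e(1)])
    fix K w x assume K: "K face_of P" "w \<in> K" and x: "x \<in> cone hull ((\<lambda>k. k - w) ` K) - {0}"
    let ?Q = "K \<inter> vert P"
    have hull: "convex hull ?Q = K"
      unfolding vert_face[OF K(1)]
      by (rule polytope_convex_hull_vert[OF face_of_polytope_polytope[OF P K(1)]])
    have fQ: "finite ?Q" "?Q \<noteq> {}" using fin hull K(2) by auto
    let ?v = "ARG_MAX (\<lambda>v. v \<bullet> x) v. v \<in> ?Q"
    show "e \<le> PdirW ?Q x w"
      unfolding PdirW_def
    proof (rule cINF_greatest)
      show "active_sets ?Q w \<noteq> {}" by (rule active_sets_exist[OF fQ(1)]) (simp add: hull K)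
      fix A assume A: "A \<in> active_sets ?Q w"
      then have fA: "finite A" "A \<subseteq> ?Q" using fQ finite_subset unfolding active_sets_def by blast+
      from A obtain u where "\<forall>a\<in>A. u a > 0" "sum u A = 1" "(\<Sum>a\<in>A. u a *\<^sub>R a) = w"
        unfolding active_sets_def by blast
      then have "w \<in> convex hull A"
        unfolding convex_hull_finite[OF fA(1)] by (auto intro!: exI[of _ u] less_imp_le)
      from cone_hull_translate_subset[OF fQ(1) fA(1) this]
      have "x \<in> convex_cone hull (D (?Q, A))" "x \<noteq> 0" using x unfolding hull D_def by auto
      moreover have J: "(?Q, A) \<in> I" unfolding I_def using fA by auto
      ultimately obtain d where "d \<in> D (?Q, A)" "d \<bullet> x \<ge> E (?Q, A) * norm x" using E(2) by blast
      then obtain q a where qa: "q \<in> ?Q" "a \<in> A" "(q - a) \<bullet> x \<ge> E (?Q, A) * norm x"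
        unfolding D_def by auto
      have "e * norm x \<le> E (?Q, A) * norm x" using e(2)[OF J] by (simp add: mult_right_mono)
      also have "\<dots> \<le> (?v - a) \<bullet> x"
        using qa(3) arg_max_inner(2)[OF fQ qa(1), of x] by (simp add: inner_diff)
      finally have "e \<le> (?v - a) \<bullet> x / norm x" using \<open>x \<noteq> 0\<close> by (simp add: field_simps)
      also have "\<dots> \<le> dirW (A \<union> {?v}) x" by (rule inner_diff_le_dirW) (use fA qa in auto)
      finally show "e \<le> dirW (A \<union> {?v}) x" .
    qed
  qed
qed

text \<open>The uniform bound makes the set bounded below, so that its real infimum is a genuine
  lower bound.\<close>

lemma PWidth_le:
  fixes P :: "'a::euclidean_space set"
  assumes "polytope P" "K face_of P" "w \<in> K" "x \<in> cone hull ((\<lambda>k. k - w) ` K) - {0}"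
  shows "PWidth P \<le> PdirW (K \<inter> vert P) x w"
  unfolding PWidth_def
proof (rule cInf_lower)
  obtain e where "\<And>K w x. K face_of P \<Longrightarrow> w \<in> K \<Longrightarrow> x \<in> cone hull ((\<lambda>k. k - w) ` K) - {0} \<Longrightarrow>
       e \<le> PdirW (K \<inter> vert P) x w"
    using PdirW_uniform_lower_bound[OF assms(1)] by metis
  then show "bdd_below {PdirW (K \<inter> vert P) x w | K w x.
      K face_of P \<and> w \<in> K \<and> x \<in> cone hull ((\<lambda>k. k - w) ` K) - {0}}"
    by (intro bdd_belowI[of _ e]) auto
qed (use assms in blast)

text \<open>Two distinct points supply an admissible direction, so the infimum is over a nonempty
  set and inherits the uniform bound.\<close>

lemma PWidth_pos:
  fixes P :: "'a::euclidean_space set"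
  assumes P: "polytope P" and wk: "w \<in> P" "k \<in> P" "w \<noteq> k"
  shows "PWidth P > 0"
proof -
  obtain e where e: "e > 0" "\<And>K w x. K face_of P \<Longrightarrow> w \<in> K \<Longrightarrow> x \<in> cone hull ((\<lambda>k. k - w) ` K) - {0} \<Longrightarrow>
       e \<le> PdirW (K \<inter> vert P) x w"
    using PdirW_uniform_lower_bound[OF P] by metis
  have "k - w \<in> cone hull ((\<lambda>k. k - w) ` P) - {0}" using wk by (auto intro: hull_inc)
  moreover have "P face_of P" using polytope_imp_convex[OF P] by (rule face_of_refl)
  ultimately have "e \<le> PWidth P"
    unfolding PWidth_def using wk(1) by (intro cInf_greatest) (use e(2) in blast)+
  then show ?thesis using e(1) by simp
qed

text \<open>The face \<open>P\<close> itself with direction \<open>k - w\<close> is admissible, and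
  Cauchy-Schwarz bounds its directional widths.\<close>

lemma PWidth_le_diameter:
  fixes P :: "'a::euclidean_space set"
  assumes P: "polytope P" and wk: "w \<in> P" "k \<in> P" "w \<noteq> k"
  shows "PWidth P \<le> diameter P"
proof -
  have face: "P face_of P" using polytope_imp_convex[OF P] by (rule face_of_refl)
  have x: "k - w \<in> cone hull ((\<lambda>k. k - w) ` P) - {0}" using wk by (auto intro: hull_inc)
  have hull: "convex hull (vert P) = P" by (rule polytope_convex_hull_vert[OF P])
  note sub = vert_subset[of P]
  then have Pv: "P \<inter> vert P = vert P" by blast
  have fV: "finite (vert P)" "vert P \<noteq> {}" using finite_vert[OF P] hull wk by auto
  obtain A where A: "A \<in> active_sets (vert P) w"
    using active_sets_exist[OF fV(1)] hull wk(1) by blast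
  let ?v = "ARG_MAX (\<lambda>v. v \<bullet> (k - w)) v. v \<in> vert P"
  have AP: "A \<union> {?v} \<subseteq> P" using A arg_max_inner(1)[OF fV] sub unfolding active_sets_def by blast
  have "PWidth P \<le> dirW (A \<union> {?v}) (k - w)"
    using PWidth_le[OF P face wk(1) x] PdirW_le[OF fV(1) A, of "k - w"] unfolding Pv by simp
  also have "\<dots> \<le> diameter P"
  proof (rule dirW_le)
    fix a b assume ab: "a \<in> A \<union> {?v}" "b \<in> A \<union> {?v}"
    have "(a - b) \<bullet> (k - w) / norm (k - w) \<le> norm (a - b)"
      using norm_cauchy_schwarz[of "a - b" "k - w"] wk by (simp add: field_simps)
    also have "\<dots> \<le> diameter P"
      using diameter_bounded_bound[OF polytope_imp_bounded[OF P], of a b] ab AP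
      by (auto simp: dist_norm)
    finally show "(a - b) \<bullet> (k - w) / norm (k - w) \<le> diameter P" .
  qed simp
  finally show ?thesis .
qed

subsection \<open>Projection of directions onto faces\<close>

text \<open>Project \<open>r\<close> onto the cone of feasible directions at \<open>w\<close>. The residual lies in the polar cone and
  exposes a face of \<open>P\<close> that contains \<open>w\<close> (hence \<open>A\<close>) and is tangent to the projection; on this face
  \<open>r\<close> and its projection have the same inner products with differences.\<close>

lemma PWidth_direction_bound:
  fixes P :: "'a::euclidean_space set"
  assumes P: "polytope P" and w: "w \<in> P" and k: "k \<in> P" and pos: "(k - w) \<bullet> r > 0"
    and A: "A \<in> active_sets (vert P) w"
    and G: "\<And>a y. a \<in> A \<Longrightarrow> y \<in> P \<Longrightarrow> (y - a) \<bullet> r \<le> G"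
  shows "PWidth P * ((k - w) \<bullet> r) \<le> G * norm (k - w)"
proof -
  define T where "T = (\<lambda>k. k - w) ` P"
  have T: "polytope T" "convex T" "0 \<in> T"
    unfolding T_def using P w
    using polytope_translation_eq[of "- w" P]
    by (auto simp: polytope_imp_convex convex_translation_subtract)
  define C where "C = cone hull T"
  have Ceq: "C = conic hull T"
    unfolding C_def using T(3) by (auto simp: cone_hull_expl conic_hull_explicit)
  \<comment> \<open>The cone over a polytope is polyhedral, hence closed, so the projection onto it
    exists.\<close>
  have C: "closed C" "convex C" "0 \<in> C"
    subgoal unfolding Ceq by (intro polyhedron_imp_closed polyhedron_conic_hull_polytope T)
    subgoal unfolding Ceq by (intro convex_conic_hull T)
    subgoal unfolding C_def using T(3) by (simp add: hull_inc)
    done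
  have cmul: "c *\<^sub>R y \<in> C" if "y \<in> C" "c \<ge> 0" for c y
    using that unfolding C_def by (simp add: mem_cone cone_cone_hull)
  define s where "s = closest_point C r"
  have s: "s \<in> C" unfolding s_def using C closest_point_in_set by blast
  have proj: "(r - s) \<bullet> (y - s) \<le> 0" if "y \<in> C" for y
    unfolding s_def by (rule closest_point_dot[OF C(2,1) that])
  \<comment> \<open>The cone contains 0 and \<open>2 *\<^sub>R s\<close>; testing the projection
    inequality there gives both signs.\<close>
  have orth: "(r - s) \<bullet> s = 0"
    using proj[of "2 *\<^sub>R s"] proj[OF C(3)] cmul[OF s, of 2] by (simp add: algebra_simps scaleR_2)
  have polar: "(r - s) \<bullet> y \<le> 0" if "y \<in> C" for y
    using proj[OF that] orth by (simp add: inner_diff_right)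
  have Pin: "y - w \<in> C" if "y \<in> P" for y
    unfolding C_def T_def using that by (auto intro: hull_inc)
  have kr: "(k - w) \<bullet> r \<le> norm s * norm (k - w)"
  proof -
    have "(k - w) \<bullet> r \<le> (k - w) \<bullet> s"
      using polar[OF Pin[OF k]] by (simp add: inner_diff inner_commute)
    also have "\<dots> \<le> norm s * norm (k - w)"
      using norm_cauchy_schwarz[of "k - w" s] by (simp add: mult.commute)
    finally show ?thesis .
  qed
  have s0: "s \<noteq> 0" using kr pos by auto
  define K where "K = P \<inter> {y. (r - s) \<bullet> y = (r - s) \<bullet> w}"
  have K: "K face_of P"
    unfolding K_def
  proof (rule face_of_Int_supporting_hyperplane_le[OF polytope_imp_convex[OF P]])
    fix y assume "y \<in> P"
    from polar[OF Pin[OF this]] show "(r - s) \<bullet> y \<le> (r - s) \<bullet> w" by (simp add: inner_diff_right)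
  qed
  have wK: "w \<in> K" unfolding K_def using w by simp
  \<comment> \<open>\<open>s\<close> is a multiple of some \<open>y - w\<close>, and orthogonality
    to the residual puts \<open>y\<close> on the exposed face.\<close>
  have sK: "s \<in> cone hull ((\<lambda>k. k - w) ` K)"
  proof -
    obtain c y where cy: "s = c *\<^sub>R (y - w)" "c \<ge> 0" "y \<in> P"
      using s unfolding C_def T_def by (auto simp: cone_hull_expl)
    then have "c \<noteq> 0" using s0 by auto
    then have "(r - s) \<bullet> (y - w) = 0" using orth unfolding cy(1) by simp
    then have "y \<in> K" unfolding K_def using cy(3) by (simp add: inner_diff_right)
    then show ?thesis using cy by (auto simp: cone_hull_expl)
  qed
  have sr: "(y - z) \<bullet> r = (y - z) \<bullet> s" if "y \<in> K" "z \<in> K" for y z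
  proof -
    have "(r - s) \<bullet> (y - z) = 0" using that unfolding K_def by (simp add: inner_diff_right)
    then show ?thesis by (simp add: inner_diff_left inner_commute)
  qed
  let ?Q = "K \<inter> vert P"
  have AV: "A \<subseteq> vert P" using A unfolding active_sets_def by blast
  have fV: "finite (vert P)" by (rule finite_vert[OF P])
  have fA: "finite A" using AV fV finite_subset by blast
  note VP = vert_subset[of P]
  have AK: "A \<subseteq> ?Q"
  proof
    fix a assume a: "a \<in> A"
    have "a \<bullet> (r - s) = w \<bullet> (r - s)"
    proof (rule active_sets_tight[OF A fA _ a])
      fix b assume "b \<in> A"
      then show "b \<bullet> (r - s) \<le> w \<bullet> (r - s)"
        using polar[OF Pin, of b] AV VP by (auto simp: inner_diff_right inner_commute)
    qed
    then have "(r - s) \<bullet> a = (r - s) \<bullet> w" by (simp add: inner_commute)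
    then show "a \<in> ?Q" unfolding K_def using a AV VP by auto
  qed
  then have AQ: "A \<in> active_sets ?Q w" using A unfolding active_sets_def by blast
  have fQ: "finite ?Q" "?Q \<noteq> {}" using fV AK active_sets_nonempty[OF A] by auto
  let ?v = "ARG_MAX (\<lambda>v. v \<bullet> s) v. v \<in> ?Q"
  note v = arg_max_inner[OF fQ, where x = s]
  have G': "(?v - a) \<bullet> s \<le> G" if "a \<in> A" for a
  proof -
    have "?v \<in> K" "?v \<in> P" "a \<in> K" using that AK v(1) VP by blast+
    then show ?thesis using G[OF that] sr by metis
  qed
  obtain a0 where a0: "a0 \<in> A" using active_sets_nonempty[OF A] by blast
  have "PWidth P \<le> dirW (A \<union> {?v}) s"
    using PWidth_le[OF P K wK, of s] PdirW_le[OF fQ(1) AQ, of s] sK s0 by simp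
  also have "\<dots> \<le> G / norm s"
  proof (rule dirW_le)
    fix b c assume bc: "b \<in> A \<union> {?v}" "c \<in> A \<union> {?v}"
    have "b \<bullet> s \<le> ?v \<bullet> s" using bc v(2) AK by blast
    \<comment> \<open>If \<open>c\<close> is \<open>?v\<close> rather than an active vertex, any
      element of \<open>A\<close> serves, because \<open>?v\<close> is maximal.\<close>
    moreover have "\<exists>a\<in>A. a \<bullet> s \<le> c \<bullet> s" using bc a0 v(2)[of a0] AK by blast
    ultimately have "(b - c) \<bullet> s \<le> G" using G' by (fastforce simp: inner_diff)
    then show "(b - c) \<bullet> s / norm s \<le> G / norm s" by (simp add: divide_right_mono)
  qed simp
  finally have W: "PWidth P * norm s \<le> G" using s0 by (simp add: field_simps)
  have "w \<noteq> k" using pos by auto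
  then have "PWidth P > 0" by (rule PWidth_pos[OF P w k])
  then have "PWidth P * ((k - w) \<bullet> r) \<le> PWidth P * (norm s * norm (k - w))"
    using kr by (simp add: mult_left_mono)
  also have "\<dots> \<le> G * norm (k - w)" using mult_right_mono[OF W, of "norm (k - w)"] by (simp add: mult.assoc)
  finally show ?thesis .
qed

subsection \<open>The base polytope\<close>

lemma polytope_base_polytope: "polytope (base_polytope F)"
proof -
  have inner_ind: "(\<Sum>k\<in>A. w $ k) = (\<chi> k. if k \<in> A then 1 else 0) \<bullet> w" for A :: "'a set" and w :: "real^'a"
    by (simp add: inner_vec_def sum.If_cases if_distrib[of "\<lambda>c. c * _"] cong: if_cong)
  have eq: "base_polytope F =
      (\<Inter>A. {w. (\<chi> k. if k \<in> A then 1 else 0) \<bullet> w \<le> F A}) \<inter>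
      {w. (\<chi> k. if k \<in> UNIV then 1 else 0) \<bullet> w = F UNIV}"
    unfolding base_polytope_def inner_ind by auto
  have "polyhedron (base_polytope F)"
    unfolding eq
    by (intro polyhedron_Int polyhedron_hyperplane polyhedron_Inter)
       (auto intro: polyhedron_halfspace_le)
  moreover have "bounded (base_polytope F)"
  proof -
    \<comment> \<open>The constraint on \<open>{k}\<close> bounds a coordinate from above; the one
      on its complement, with the fixed total, bounds it from below.\<close>
    have "base_polytope F \<subseteq> cbox (\<chi> k. F UNIV - F (UNIV - {k})) (\<chi> k. F {k})"
    proof
      fix w assume w: "w \<in> base_polytope F"
      have "w $ k \<le> F {k}" "F UNIV - F (UNIV - {k}) \<le> w $ k" for k
      proof -
        have "(\<Sum>j\<in>{k}. w $ j) \<le> F {k}" "(\<Sum>j\<in>UNIV - {k}. w $ j) \<le> F (UNIV - {k})"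
          "(\<Sum>j\<in>UNIV. w $ j) = F UNIV"
          using w unfolding base_polytope_def by blast+
        then show "w $ k \<le> F {k}" "F UNIV - F (UNIV - {k}) \<le> w $ k"
          by (simp_all add: sum_diff1)
      qed
      then show "w \<in> cbox (\<chi> k. F UNIV - F (UNIV - {k})) (\<chi> k. F {k})"
        by (simp add: mem_box_cart)
    qed
    then show ?thesis using bounded_cbox bounded_subset by blast
  qed
  ultimately show ?thesis by (simp add: polytope_eq_bounded_polyhedron)
qed

subsection \<open>Rate arithmetic\<close>

text \<open>\<open>h\<close> is the suboptimality, \<open>G\<close> the duality gap, \<open>D\<close> the dual progress of one step; \<open>q\<close> and \<open>s\<close> are
  the directional derivative towards and the distance to the dual optimum, and \<open>W\<close> is the
  pyramidal width.\<close>

lemma linear_rate_step: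
  fixes h G D q s W M \<alpha> \<beta> :: real
  assumes pos: "\<alpha> > 0" "\<beta> > 0" "M > 0" "W > 0" and le: "\<beta> \<le> \<alpha>" "W \<le> M"
    and h: "h \<ge> 0" "h \<le> q - s\<^sup>2 / (2 * \<alpha>)" and s: "s \<ge> 0" and q: "q \<le> G"
    and width: "q > 0 \<Longrightarrow> W * q \<le> G * s"
    and D: "\<And>t. 0 \<le> t \<Longrightarrow> t \<le> 1 \<Longrightarrow> t * G - t\<^sup>2 * M\<^sup>2 / (2 * \<beta>) \<le> D"
  shows "\<beta> / (4 * \<alpha>) * (W / M)\<^sup>2 * h \<le> D"
proof (cases "h = 0")
  case True then show ?thesis using D[of 0] by simp
next
  case False
  have "s\<^sup>2 / (2 * \<alpha>) \<ge> 0" using pos by simp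
  then have q0: "q > 0" "h \<le> q" using False h by linarith+
  have G: "G > 0" using q0 q by simp
  have r: "\<beta> / \<alpha> \<le> 1" "(W / M)\<^sup>2 \<le> 1" using pos le by (auto simp: power_le_one)
  \<comment> \<open>The progress bound is maximal at \<open>t = G * \<beta> / M\<^sup>2\<close>. The
    cases tell whether this step is at most 1; otherwise \<open>t = 1\<close> is used.\<close>
  show ?thesis
  proof (cases "G \<le> M\<^sup>2 / \<beta>")
    case True
    \<comment> \<open>The unknown distance \<open>s\<close> is eliminated by completing the square
      in \<open>W * s\<close>.\<close>
    have "2 * \<alpha> * W\<^sup>2 * h \<le> (\<alpha> * G)\<^sup>2"
    proof -
      have "W * h \<le> W * (q - s\<^sup>2 / (2 * \<alpha>))" using h(2) pos by (simp add: mult_left_mono)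
      also have "\<dots> \<le> G * s - W * (s\<^sup>2 / (2 * \<alpha>))" using width[OF q0(1)] by (simp add: algebra_simps)
      finally have "(2 * \<alpha> * W) * (W * h) \<le> (2 * \<alpha> * W) * (G * s - W * (s\<^sup>2 / (2 * \<alpha>)))"
        using pos by (intro mult_left_mono) auto
      also have "\<dots> = 2 * (\<alpha> * G) * (W * s) - (W * s)\<^sup>2"
        using pos by (simp add: field_simps power2_eq_square)
      also have "\<dots> \<le> (\<alpha> * G)\<^sup>2"
        using zero_le_power2[of "\<alpha> * G - W * s"] by (simp add: power2_diff)
      finally show ?thesis by (simp add: power2_eq_square mult_ac)
    qed
    then have "2 * (W\<^sup>2 * h) \<le> \<alpha> * G\<^sup>2"
      using pos by (simp add: power2_eq_square mult_ac)
    then have "\<beta> / (4 * \<alpha> * M\<^sup>2) * (2 * (W\<^sup>2 * h)) \<le> \<beta> / (4 * \<alpha> * M\<^sup>2) * (\<alpha> * G\<^sup>2)"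
      using pos by (intro mult_left_mono) auto
    then have "\<beta> / (4 * \<alpha>) * (W / M)\<^sup>2 * h \<le> G\<^sup>2 * \<beta> / (8 * M\<^sup>2)"
      using pos by (simp add: field_simps)
    also have "\<dots> \<le> G\<^sup>2 * \<beta> / (2 * M\<^sup>2)" using pos by (intro divide_left_mono) auto
    also have "\<dots> = (G * \<beta> / M\<^sup>2) * G - (G * \<beta> / M\<^sup>2)\<^sup>2 * M\<^sup>2 / (2 * \<beta>)"
      using pos by (simp add: field_simps power2_eq_square)
    also have "\<dots> \<le> D" using True G pos by (intro D) (auto simp: field_simps)
    finally show ?thesis .
  next
    case False
    then have "M\<^sup>2 / (2 * \<beta>) \<le> G / 2" using pos by (simp add: field_simps)
    moreover have "G - M\<^sup>2 / (2 * \<beta>) \<le> D" using D[of 1] by simp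
    ultimately have "h / 2 \<le> D" using q q0 by linarith
    moreover have "\<beta> / \<alpha> * (W / M)\<^sup>2 * h \<le> 1 * 1 * h"
      using r h pos by (intro mult_right_mono mult_mono) auto
    then have "\<beta> / (4 * \<alpha>) * (W / M)\<^sup>2 * h \<le> h / 4" using pos by simp
    ultimately show ?thesis using h(1) by linarith
  qed
qed

text \<open>The first bound is \<open>t = 1\<close>. For small \<open>h\<close> it yields
  \<open>G \<le> M\<^sup>2 / \<beta>\<close>, so the optimal
  \<open>t = G * \<beta> / M\<^sup>2\<close> is admissible and gives the second.\<close>

lemma gap_bound:
  fixes h G M \<beta> :: real
  assumes pos: "\<beta> > 0" "M \<ge> 0"
    and D: "\<And>t. 0 \<le> t \<Longrightarrow> t \<le> 1 \<Longrightarrow> t * G - t\<^sup>2 * M\<^sup>2 / (2 * \<beta>) \<le> h"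
  shows "G \<le> h + M\<^sup>2 / (2 * \<beta>)"
    and "h < M\<^sup>2 / (2 * \<beta>) \<Longrightarrow> G \<le> M * sqrt (2 * h / \<beta>)"
proof -
  show 1: "G \<le> h + M\<^sup>2 / (2 * \<beta>)" using D[of 1] by simp
  have h: "0 \<le> h" using D[of 0] by simp
  assume *: "h < M\<^sup>2 / (2 * \<beta>)"
  then have M: "M > 0" using h pos by (cases "M = 0") auto
  show "G \<le> M * sqrt (2 * h / \<beta>)"
  proof (cases "G \<le> 0")
    case True
    moreover have "0 \<le> M * sqrt (2 * h / \<beta>)" using h pos by simp
    ultimately show ?thesis by linarith
  next
    case False
    have "G \<le> M\<^sup>2 / \<beta>" using 1 * by (simp add: field_simps)
    then have "(G * \<beta> / M\<^sup>2) * G - (G * \<beta> / M\<^sup>2)\<^sup>2 * M\<^sup>2 / (2 * \<beta>) \<le> h"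
      using False M pos by (intro D) (auto simp: field_simps)
    moreover have "(G * \<beta> / M\<^sup>2) * G - (G * \<beta> / M\<^sup>2)\<^sup>2 * M\<^sup>2 / (2 * \<beta>) = (G / M)\<^sup>2 * \<beta> / 2"
      using M pos by (simp add: field_simps power2_eq_square)
    ultimately have "(G / M)\<^sup>2 \<le> 2 * h / \<beta>" using pos by (simp add: field_simps)
    then have "G / M \<le> sqrt (2 * h / \<beta>)" by (rule real_le_rsqrt)
    then show ?thesis using M by (simp add: field_simps)
  qed
qed

subsection \<open>Iterations of the simplicial method\<close>

lemma osm_performed_Suc:
  "osm_performed g F \<epsilon> V x (i + 1) \<Longrightarrow> i \<ge> 1 \<Longrightarrow> osm_performed g F \<epsilon> V x i \<and> \<not> osm_stops g F \<epsilon> V x i"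
  unfolding osm_performed_def by auto

context
  fixes F :: "'n::finite set \<Rightarrow> real"
    and g :: "real^'n \<Rightarrow> real"
    and \<beta> \<epsilon> :: real
    and V :: "nat \<Rightarrow> (real^'n) set"
    and x v :: "nat \<Rightarrow> real^'n"
  assumes g: "strongly_convex \<beta> g" and run: "osm_run g F \<epsilon> V x v"
begin

text \<open>Iteration \<open>i\<close> works with \<open>V (i - 1)\<close>. The sequences are
  constrained only while iterations are performed, so the induction carries that condition
  along.\<close>

lemma osm_vertices:
  assumes "osm_performed g F \<epsilon> V x i"
  shows "V (i - 1) \<noteq> {} \<and> V (i - 1) \<subseteq> vert (base_polytope F)"
  using assms
proof (induction i)
  case 0 then show ?case by (simp add: osm_performed_def)
next
  case (Suc i)
  show ?case
  proof (cases "i = 0")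
    case True then show ?thesis using run unfolding osm_run_def by simp
  next
    case False
    with osm_performed_Suc[of g F \<epsilon> V x i] Suc.prems
    have i: "osm_performed g F \<epsilon> V x i" "\<not> osm_stops g F \<epsilon> V x i" by auto
    then have "V i = V (i - 1) \<union> {v i}" "v i \<in> vert (base_polytope F)"
      using run unfolding osm_run_def by blast+
    then show ?thesis using Suc.IH[OF i(1)] by simp
  qed
qed

lemma base_polytope_nonempty: "base_polytope F \<noteq> {}"
  using run vert_subset unfolding osm_run_def by blast

lemma lovasz_extension_ge:
  assumes "w \<in> base_polytope F"
  shows "w \<bullet> y \<le> lovasz_extension F y"
  unfolding lovasz_extension_def
proof (rule cSUP_upper[OF assms])
  have "compact (base_polytope F)" by (intro polytope_imp_compact polytope_base_polytope)
  then show "bdd_above ((\<lambda>w. w \<bullet> y) ` base_polytope F)"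
    by (intro bounded_imp_bdd_above compact_imp_bounded compact_continuous_image continuous_intros)
qed

text \<open>The dual view of one iteration: \<open>w\<close> is the dual point behind
  \<open>x i\<close>. As \<open>v i\<close> attains the Lovasz extension, the gap is the slope of
  the dual function at \<open>w\<close> towards \<open>v i\<close>.\<close>

lemma osm_iterate:
  assumes i: "osm_performed g F \<epsilon> V x i"
  obtains w where "w \<in> convex hull V (i - 1)" "w \<in> base_polytope F" "x i = dual_argmin g w"
    "\<And>c. c \<in> convex hull V (i - 1) \<Longrightarrow> c \<bullet> x i \<le> w \<bullet> x i"
    "osm_d g V x i = dual_value g w" "osm_p g F x i - osm_d g V x i = (v i - w) \<bullet> x i"
    "v i \<in> base_polytope F" "\<And>y. y \<in> base_polytope F \<Longrightarrow> y \<bullet> x i \<le> v i \<bullet> x i"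
proof -
  have V: "V (i - 1) \<noteq> {}" "V (i - 1) \<subseteq> vert (base_polytope F)" using osm_vertices[OF i] by auto
  have fin: "finite (V (i - 1))"
    using V(2) finite_vert[OF polytope_base_polytope] finite_subset by blast
  have step: "is_arg_min (\<lambda>y. g y + (SUP w\<in>V (i - 1). w \<bullet> y)) (\<lambda>y. True) (x i)"
    and max: "is_arg_max (\<lambda>w. w \<bullet> x i) (\<lambda>w. w \<in> base_polytope F) (v i)"
    using run i unfolding osm_run_def osm_f_def by blast+
  obtain w where w: "w \<in> convex hull V (i - 1)" "x i = dual_argmin g w"
    "\<And>c. c \<in> convex hull V (i - 1) \<Longrightarrow> c \<bullet> x i \<le> w \<bullet> x i"
    "g (x i) + (SUP w\<in>V (i - 1). w \<bullet> x i) = dual_value g w"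
    using restricted_minimizer[OF g fin V(1) step] by blast
  have d: "osm_d g V x i = dual_value g w" using w(4) unfolding osm_d_def osm_f_def .
  have vi: "v i \<in> base_polytope F" "\<And>y. y \<in> base_polytope F \<Longrightarrow> y \<bullet> x i \<le> v i \<bullet> x i"
    using max by (auto simp: is_arg_max_linorder)
  have "lovasz_extension F (x i) = v i \<bullet> x i"
    unfolding lovasz_extension_def
    by (rule antisym[OF cSUP_least lovasz_extension_ge[unfolded lovasz_extension_def]])
       (use vi base_polytope_nonempty in auto)
  then have gap: "osm_p g F x i - osm_d g V x i = (v i - w) \<bullet> x i"
    using w(2) unfolding d osm_p_def dual_value_def by (simp add: inner_diff)
  have "convex hull V (i - 1) \<subseteq> base_polytope F"
    using V(2) vert_subset
    by (intro hull_minimal polytope_imp_convex polytope_base_polytope) blast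
  then have "w \<in> base_polytope F" using w(1) by blast
  then show ?thesis using that w d gap vi by blast
qed

text \<open>Weak duality.\<close>

lemma dual_value_le_primal_opt:
  assumes "w \<in> base_polytope F"
  shows "dual_value g w \<le> primal_opt g F"
  unfolding primal_opt_def
proof (rule cINF_greatest)
  show "dual_value g w \<le> g y + lovasz_extension F y" for y
    using dual_value_le[OF g, of w y] lovasz_extension_ge[OF assms, of y] by linarith
qed simp

text \<open>Strong duality, from a saddle point over the whole base polytope.\<close>

lemma dual_optimum:
  obtains w where "w \<in> base_polytope F" "primal_opt g F = dual_value g w"
proof -
  have P: "compact (base_polytope F)" "convex (base_polytope F)"
    using polytope_base_polytope polytope_imp_compact polytope_imp_convex by blast+
  obtain w where w: "w \<in> base_polytope F"
      "\<And>c. c \<in> base_polytope F \<Longrightarrow> c \<bullet> dual_argmin g w \<le> w \<bullet> dual_argmin g w"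
    using dual_value_saddle[OF g P base_polytope_nonempty] by blast
  have "primal_opt g F \<le> g (dual_argmin g w) + lovasz_extension F (dual_argmin g w)"
    unfolding primal_opt_def
  proof (rule cINF_lower)
    show "bdd_below (range (\<lambda>x. g x + lovasz_extension F x))"
    proof (rule bdd_belowI2)
      show "dual_value g w \<le> g y + lovasz_extension F y" for y
        using dual_value_le[OF g, of w y] lovasz_extension_ge[OF w(1), of y] by linarith
    qed
  qed simp
  also have "lovasz_extension F (dual_argmin g w) \<le> w \<bullet> dual_argmin g w"
    unfolding lovasz_extension_def by (rule cSUP_least[OF base_polytope_nonempty w(2)])
  finally have "primal_opt g F \<le> dual_value g w" unfolding dual_value_def by simp
  then show ?thesis using that[OF w(1)] dual_value_le_primal_opt[OF w(1)] by simp
qed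

lemma dual_value_line:
  assumes "w \<in> base_polytope F" "y \<in> base_polytope F"
  shows "dual_value g w + t * ((y - w) \<bullet> dual_argmin g w)
      - t\<^sup>2 * (diameter (base_polytope F))\<^sup>2 / (2 * \<beta>) \<le> dual_value g (w + t *\<^sub>R (y - w))"
proof -
  have b: "\<beta> > 0" using g unfolding strongly_convex_def by simp
  have "norm (y - w) \<le> diameter (base_polytope F)"
    using diameter_bounded_bound[OF polytope_imp_bounded[OF polytope_base_polytope] assms(2,1)]
    by (simp add: dist_norm)
  then have "(norm (y - w))\<^sup>2 \<le> (diameter (base_polytope F))\<^sup>2" by (intro power_mono) auto
  then have "t\<^sup>2 * (norm (y - w))\<^sup>2 / (2 * \<beta>) \<le> t\<^sup>2 * (diameter (base_polytope F))\<^sup>2 / (2 * \<beta>)"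
    using b by (intro divide_right_mono mult_left_mono) auto
  then show ?thesis
    using dual_value_lower[OF g, of w "w + t *\<^sub>R (y - w)"] by (simp add: power_mult_distrib)
qed

text \<open>The segment from \<open>w\<close> to \<open>v i\<close> stays in the base polytope, so
  weak duality caps the dual increase along it.\<close>

lemma osm_gap_quadratic:
  assumes i: "osm_performed g F \<epsilon> V x i" and t: "0 \<le> t" "t \<le> 1"
  shows "t * (osm_p g F x i - osm_d g V x i) - t\<^sup>2 * (diameter (base_polytope F))\<^sup>2 / (2 * \<beta>)
      \<le> primal_opt g F - osm_d g V x i"
proof -
  obtain w where w: "w \<in> base_polytope F" "x i = dual_argmin g w" "osm_d g V x i = dual_value g w"
      "osm_p g F x i - osm_d g V x i = (v i - w) \<bullet> x i" "v i \<in> base_polytope F"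
    by (rule osm_iterate[OF i])
  have "w + t *\<^sub>R (v i - w) \<in> base_polytope F"
    by (rule convex_line[OF polytope_imp_convex[OF polytope_base_polytope] w(1,5) t])
  from dual_value_le_primal_opt[OF this] dual_value_line[OF w(1,5), of t]
  show ?thesis unfolding w(4) unfolding w(2,3) by linarith
qed

lemma osm_linear_step:
  assumes i: "osm_performed g F \<epsilon> V x i" and i': "osm_performed g F \<epsilon> V x (i + 1)"
    and a: "smooth_fun \<alpha> g"
    and P2: "a1 \<in> base_polytope F" "a2 \<in> base_polytope F" "a1 \<noteq> a2"
  defines "\<rho> \<equiv> \<beta> / (4 * \<alpha>) * (PWidth (base_polytope F) / diameter (base_polytope F))\<^sup>2"
  shows "primal_opt g F - osm_d g V x (i + 1) \<le> (1 - \<rho>) * (primal_opt g F - osm_d g V x i)"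
proof -
  let ?P = "base_polytope F"
  let ?M = "diameter ?P"
  note P = polytope_base_polytope[of F]
  obtain w where w: "w \<in> convex hull V (i - 1)" "w \<in> ?P" "x i = dual_argmin g w"
    "\<And>c. c \<in> convex hull V (i - 1) \<Longrightarrow> c \<bullet> x i \<le> w \<bullet> x i"
    "osm_d g V x i = dual_value g w" "osm_p g F x i - osm_d g V x i = (v i - w) \<bullet> x i"
    "v i \<in> ?P" "\<And>y. y \<in> ?P \<Longrightarrow> y \<bullet> x i \<le> v i \<bullet> x i"
    using osm_iterate[OF i] by blast
  obtain w' where w': "w' \<in> convex hull V i" "x (i + 1) = dual_argmin g w'"
    "\<And>c. c \<in> convex hull V i \<Longrightarrow> c \<bullet> x (i + 1) \<le> w' \<bullet> x (i + 1)"
    "osm_d g V x (i + 1) = dual_value g w'"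
    using osm_iterate[OF i'] by (metis add_diff_cancel_right')
  obtain k where k: "k \<in> ?P" "primal_opt g F = dual_value g k" using dual_optimum by blast
  have "i \<ge> 1" using i unfolding osm_performed_def by simp
  with osm_performed_Suc[OF i'] have "\<not> osm_stops g F \<epsilon> V x i" by simp
  then have Vi: "V i = V (i - 1) \<union> {v i}" using run i unfolding osm_run_def by blast
  have V: "V (i - 1) \<subseteq> vert ?P" using osm_vertices[OF i] by blast
  have fin: "finite (V (i - 1))" using V finite_vert[OF P] finite_subset by blast
  let ?G = "(v i - w) \<bullet> x i"
  let ?D = "dual_value g w' - dual_value g w"
  \<comment> \<open>The next dual point \<open>w'\<close> is optimal over
    \<open>convex hull V i\<close>, which contains the whole segment from \<open>w\<close> to
    \<open>v i\<close>.\<close>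
  have D: "t * ?G - t\<^sup>2 * ?M\<^sup>2 / (2 * \<beta>) \<le> ?D" if t: "0 \<le> t" "t \<le> 1" for t
  proof -
    have "w \<in> convex hull V i" using w(1) hull_mono[of "V (i - 1)" "V i"] Vi by blast
    moreover have "v i \<in> convex hull V i" unfolding Vi by (simp add: hull_inc)
    ultimately have c: "w + t *\<^sub>R (v i - w) \<in> convex hull V i"
      using t by (intro convex_line) auto
    have "dual_value g (w + t *\<^sub>R (v i - w)) \<le> dual_value g w'"
      using dual_value_upper[OF g, of "w + t *\<^sub>R (v i - w)" w'] w'(3)[OF c] w'(2)
      by (simp add: inner_diff_left)
    then show ?thesis using dual_value_line[OF w(2,7), of t] w(3) by simp
  qed
  obtain A where A: "A \<in> active_sets (V (i - 1)) w"
    using active_sets_exist[OF fin w(1)] by blast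
  have AP: "A \<in> active_sets (vert ?P) w" using A V unfolding active_sets_def by blast
  have AV: "A \<subseteq> V (i - 1)" using A unfolding active_sets_def by blast
  then have fA: "finite A" using fin finite_subset by blast
  \<comment> \<open>Optimality of \<open>w\<close> over the current hull bounds
    \<open>b \<bullet> x i\<close> by \<open>w \<bullet> x i\<close>. With equality on
    \<open>A\<close>, the gap dominates every \<open>(y - b) \<bullet> x i\<close>, as the width
    bound requires.\<close>
  have tight: "b \<bullet> x i = w \<bullet> x i" if "b \<in> A" for b
    by (rule active_sets_tight[OF A fA _ that]) (use w(4) AV in \<open>blast intro: hull_inc\<close>)
  have width: "PWidth ?P * ((k - w) \<bullet> x i) \<le> ?G * norm (k - w)" if "(k - w) \<bullet> x i > 0"
  proof (rule PWidth_direction_bound[OF P w(2) k(1) that AP])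
    fix b y assume "b \<in> A" "y \<in> ?P"
    then show "(y - b) \<bullet> x i \<le> ?G" using tight w(8) by (simp add: inner_diff_left)
  qed
  have pos: "\<alpha> > 0" "\<beta> > 0" using a g unfolding smooth_fun_def strongly_convex_def by auto
  have W: "PWidth ?P > 0" "PWidth ?P \<le> ?M"
    using PWidth_pos[OF P P2] PWidth_le_diameter[OF P P2] by auto
  let ?h = "primal_opt g F - osm_d g V x i"
  have "\<rho> * ?h \<le> ?D"
    unfolding \<rho>_def
  proof (rule linear_rate_step[where q = "(k - w) \<bullet> x i" and s = "norm (k - w)" and G = ?G])
    show "?h \<le> (k - w) \<bullet> x i - (norm (k - w))\<^sup>2 / (2 * \<alpha>)"
      using dual_value_upper_smooth[OF g a, of k w] unfolding k(2) w(5) w(3) by linarith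
    show "0 \<le> ?h" using dual_value_le_primal_opt[OF w(2)] w(5) by simp
    show "(k - w) \<bullet> x i \<le> ?G" using w(8)[OF k(1)] by (simp add: inner_diff_left)
    show "\<beta> \<le> \<alpha>" by (rule strongly_convex_le_smooth[OF g a])
  qed (use pos W D width in auto)
  then show ?thesis unfolding w'(4) w(5) by (simp add: algebra_simps)
qed

end

text \<open>Linear convergence of the gap is stated as an explicit bound with ratio
  \<open>sqrt (1 - \<rho>)\<close>: below the threshold, the gap is controlled only by the square
  root of the suboptimality.\<close>

theorem theorem6p4:
  fixes F :: "'n::finite set \<Rightarrow> real"
    and g :: "real^'n \<Rightarrow> real"
    and \<beta> \<epsilon> :: real
    and V :: "nat \<Rightarrow> (real^'n) set"
    and x v :: "nat \<Rightarrow> real^'n"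
  defines "M \<equiv> diameter (base_polytope F)"
    and "p_star \<equiv> primal_opt g F"
    and "p \<equiv> osm_p g F x"
    and "d \<equiv> osm_d g V x"
    and "performed \<equiv> osm_performed g F \<epsilon> V x"
  assumes "submodular F" and "F {} = 0"
    and "strongly_convex \<beta> g"
    and "\<epsilon> \<ge> 0"
    and "osm_run g F \<epsilon> V x v"
  shows "(\<forall>i. performed i \<longrightarrow>
            (p_star - d i \<ge> M\<^sup>2 / (2 * \<beta>) \<longrightarrow> p i - d i \<le> (p_star - d i) + M\<^sup>2 / (2 * \<beta>)) \<and>
            (p_star - d i < M\<^sup>2 / (2 * \<beta>) \<longrightarrow> p i - d i \<le> M * sqrt (2 * (p_star - d i) / \<beta>))) \<and>
         (\<forall>\<alpha>. smooth_fun \<alpha> g \<and> \<not> (\<exists>w. base_polytope F = {w}) \<longrightarrow>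
            (let \<rho> = \<beta> / (4 * \<alpha>) * (PWidth (base_polytope F) / M)\<^sup>2 in
               0 < \<rho> \<and> \<rho> < 1 \<and>
               (\<forall>i. performed i \<and> performed (i + 1) \<longrightarrow>
                  p_star - d (i + 1) \<le> (1 - \<rho>) * (p_star - d i)) \<and>
               (\<forall>i. performed i \<longrightarrow>
                  p i - d i \<le> max (2 * (p_star - d 1)) (M * sqrt (2 * (p_star - d 1) / \<beta>))
                                * sqrt (1 - \<rho>) ^ (i - 1))))"
proof -
  note g = \<open>strongly_convex \<beta> g\<close> and run = \<open>osm_run g F \<epsilon> V x v\<close>
  have b: "\<beta> > 0" using g unfolding strongly_convex_def by simp
  note P = polytope_base_polytope[of F]
  have M0: "M \<ge> 0" unfolding M_def by (rule diameter_ge_0[OF polytope_imp_bounded[OF P]])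
  have quad: "t * (p i - d i) - t\<^sup>2 * M\<^sup>2 / (2 * \<beta>) \<le> p_star - d i"
    if "performed i" "0 \<le> t" "t \<le> 1" for i t
    using osm_gap_quadratic[OF g run] that
    unfolding M_def p_star_def p_def d_def performed_def by blast
  have gap1: "p i - d i \<le> (p_star - d i) + M\<^sup>2 / (2 * \<beta>)" if "performed i" for i
    by (rule gap_bound(1)[OF b M0 quad[OF that]])
  have gap2: "p i - d i \<le> M * sqrt (2 * (p_star - d i) / \<beta>)"
    if "performed i" "p_star - d i < M\<^sup>2 / (2 * \<beta>)" for i
    using gap_bound(2)[OF b M0 quad[OF that(1)] that(2)] .
  have h0: "p_star - d i \<ge> 0" if "performed i" for i using quad[OF that, of 0] by simp
  have "let \<rho> = \<beta> / (4 * \<alpha>) * (PWidth (base_polytope F) / M)\<^sup>2 in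
               0 < \<rho> \<and> \<rho> < 1 \<and>
               (\<forall>i. performed i \<and> performed (i + 1) \<longrightarrow>
                  p_star - d (i + 1) \<le> (1 - \<rho>) * (p_star - d i)) \<and>
               (\<forall>i. performed i \<longrightarrow>
                  p i - d i \<le> max (2 * (p_star - d 1)) (M * sqrt (2 * (p_star - d 1) / \<beta>))
                                * sqrt (1 - \<rho>) ^ (i - 1))"
    if a: "smooth_fun \<alpha> g" and ns: "\<not> (\<exists>w. base_polytope F = {w})" for \<alpha>
  proof -
    define \<rho> where "\<rho> = \<beta> / (4 * \<alpha>) * (PWidth (base_polytope F) / M)\<^sup>2"
    obtain a1 a2 where P2: "a1 \<in> base_polytope F" "a2 \<in> base_polytope F" "a1 \<noteq> a2"
      using ns base_polytope_nonempty[OF g run] by blast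
    have W: "PWidth (base_polytope F) > 0" "PWidth (base_polytope F) \<le> M"
      using PWidth_pos[OF P P2] PWidth_le_diameter[OF P P2] unfolding M_def by auto
    have \<alpha>: "\<alpha> > 0" "\<beta> \<le> \<alpha>"
      using a strongly_convex_le_smooth[OF g a] unfolding smooth_fun_def by auto
    have \<rho>0: "0 < \<rho>" unfolding \<rho>_def using W \<alpha> b by auto
    \<comment> \<open>Both \<open>\<beta> / \<alpha>\<close> and the ratio of width to diameter are
      at most 1.\<close>
    have "\<beta> / (4 * \<alpha>) * (PWidth (base_polytope F) / M)\<^sup>2 \<le> 1 / 4 * 1"
      using W \<alpha> b by (intro mult_mono) (auto simp: power_le_one field_simps)
    then have \<rho>1: "\<rho> < 1" unfolding \<rho>_def by simp
    have step: "p_star - d (i + 1) \<le> (1 - \<rho>) * (p_star - d i)"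
      if "performed i" "performed (i + 1)" for i
      using osm_linear_step[OF g run _ _ a P2, of i] that
      unfolding M_def p_star_def d_def performed_def \<rho>_def by blast
    have rate: "performed (Suc j) \<Longrightarrow> p_star - d (Suc j) \<le> (1 - \<rho>) ^ j * (p_star - d 1)" for j
    proof (induction j)
      case 0 then show ?case by simp
    next
      case (Suc j)
      have pj: "performed (Suc j)"
        using Suc.prems osm_performed_Suc[of g F \<epsilon> V x "Suc j"] unfolding performed_def by simp
      have "p_star - d (Suc (Suc j)) \<le> (1 - \<rho>) * (p_star - d (Suc j))"
        using step[OF pj] Suc.prems by simp
      also have "\<dots> \<le> (1 - \<rho>) * ((1 - \<rho>) ^ j * (p_star - d 1))"
        using Suc.IH[OF pj] \<rho>1 by (intro mult_left_mono) auto
      finally show ?case by simp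
    qed
    have gap: "p i - d i \<le> max (2 * (p_star - d 1)) (M * sqrt (2 * (p_star - d 1) / \<beta>))
                                * sqrt (1 - \<rho>) ^ (i - 1)" (is "_ \<le> max ?A ?B * ?r ^ _")
      if i: "performed i" for i
    proof -
      obtain j where j: "i = Suc j" using i unfolding performed_def osm_performed_def by (cases i) auto
      have "performed 1" unfolding performed_def osm_performed_def by simp
      note h1 = h0[OF this]
      have r: "0 \<le> ?r" "?r \<le> 1" "(1 - \<rho>) ^ j = ?r ^ j * ?r ^ j"
        using \<rho>0 \<rho>1 by (auto simp flip: power_mult_distrib)
      have hj: "p_star - d i \<le> ?r ^ j * ?r ^ j * (p_star - d 1)"
        using rate[of j] i r(3) unfolding j by simp
      have rj: "0 \<le> ?r ^ j" "?r ^ j \<le> 1" using r by (auto simp: power_le_one)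
      \<comment> \<open>The suboptimality decays like \<open>?r ^ j * ?r ^ j\<close>. Above the
        threshold the gap is at most twice it and one factor is dropped; below, the square root
        leaves one factor.\<close>
      have "p i - d i \<le> ?A * ?r ^ j \<or> p i - d i \<le> ?B * ?r ^ j"
      proof (cases "p_star - d i < M\<^sup>2 / (2 * \<beta>)")
        case False
        then have "M\<^sup>2 / (2 * \<beta>) \<le> p_star - d i" by (rule leI)
        from order_trans[OF gap1[OF i] add_left_mono[OF this]]
        have "p i - d i \<le> 2 * (p_star - d i)" by simp
        also have "\<dots> \<le> 2 * (?r ^ j * ?r ^ j * (p_star - d 1))" using hj by simp
        also have "\<dots> \<le> 2 * (?r ^ j * 1 * (p_star - d 1))"
          using rj h1 by (intro mult_left_mono mult_right_mono) auto
        also have "\<dots> = ?A * ?r ^ j" by simp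
        finally show ?thesis by (rule disjI1)
      next
        case True
        then have "p i - d i \<le> M * sqrt (2 * (p_star - d i) / \<beta>)" by (rule gap2[OF i])
        also have "\<dots> \<le> M * sqrt (2 * (?r ^ j * ?r ^ j * (p_star - d 1)) / \<beta>)"
          using hj b M0 by (intro mult_left_mono real_sqrt_le_mono divide_right_mono) auto
        also have "2 * (?r ^ j * ?r ^ j * (p_star - d 1)) / \<beta> = (?r ^ j)\<^sup>2 * (2 * (p_star - d 1) / \<beta>)"
          by (simp add: power2_eq_square)
        also have "sqrt \<dots> = ?r ^ j * sqrt (2 * (p_star - d 1) / \<beta>)"
          unfolding real_sqrt_mult using rj by simp
        finally show ?thesis by (simp add: mult_ac)
      qed
      moreover have "?A * ?r ^ j \<le> max ?A ?B * ?r ^ j" "?B * ?r ^ j \<le> max ?A ?B * ?r ^ j"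
        using rj by (intro mult_right_mono; simp)+
      ultimately have "p i - d i \<le> max ?A ?B * ?r ^ j" by linarith
      then show ?thesis unfolding j by simp
    qed
    show ?thesis
      unfolding Let_def \<rho>_def[symmetric] using \<rho>0 \<rho>1 step gap by blast
  qed
  then show ?thesis using gap1 gap2 by blast
qed

end
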